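(* Let $\mathbb{K}$ be an algebraically closed field, $V$ a $\mathbb{K}$-vector space of finite positive dimension, and $\Phi=(A;\{E_i\}_{i=0}^d;A^*;\{E_i^*\}_{i=0}^d)$ a TD system on $V$ of diameter $d\geq 1$ that has $q$-Racah type, with fixed associated scalars $q,a,b$. Let the subspaces $W_i$ be as defined in the context. Then for $0\leq i\leq d$, $$(A-(a+a^{-1})q^{d-2i}I)W_i\subseteq W_{i-1}+W_{i+1}.$$
   Context: TD pair: an ordered pair of linear maps $A,A^*:V\to V$ such that (i) each is diagonalizable; (ii) there is an ordering $\{V_i\}_{i=0}^d$ of the eigenspaces of $A$ with $A^*V_i\subseteq V_{i-1}+V_i+V_{i+1}$ for $0\le i\le d$ ($V_{-1}=V_{d+1}=0$); (iii) there is an ordering $\{V_i^*\}_{i=0}^\delta$ of the eigenspaces of $A^*$ with $AV_i^*\subseteq V_{i-1}^*+V_i^*+V_{i+1}^*$ for $0\le i\le\delta$ ($V^*_{-1}=V^*_{\delta+1}=0$); (iv) no subspace $W$ with $0\ne W\ne V$ satisfies $AW\subseteq W$ and $A^*W\subseteq W$. It is known that $d=\delta$; $d$ is called the diameter. Orderings as in (ii), (iii) are called standard. The primitive idempotent of $A$ for an eigenspace $V_i$ is the projection of $V$ onto $V_i$ that vanishes on the other eigenspaces (similarly for $A^*$). TD system: $(A;\{E_i\}_{i=0}^d;A^*;\{E_i^*\}_{i=0}^d)$ where $A,A^*$ is a TD pair and $\{E_i\}$, $\{E_i^*\}$ are the primitive idempotents of $A$, $A^*$, in orders for which the corresponding eigenspace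 orderings $\{E_iV\}$, $\{E_i^*V\}$ are standard. Let $\theta_i$ (resp. $\theta_i^*$) be the eigenvalue of $A$ on $E_iV$ (resp. of $A^*$ on $E_i^*V$). $\Phi$ has $q$-Racah type if there are nonzero $q,a,b\in\mathbb{K}$ with $q^4\ne1$ and $\theta_i=aq^{d-2i}+a^{-1}q^{2i-d}$, $\theta_i^*=bq^{d-2i}+b^{-1}q^{2i-d}$ for $0\le i\le d$. (Distinctness of eigenvalues forces $q^{2i}\neq1$ for $1\le i\le d$, and $a^2\ne q^{2d-2},q^{2d-4},\dots,q^{2-2d}$; in particular $a^2\neq 1$.) Split decompositions: $U_i=(E_0^*V+\cdots+E_i^*V)\cap(E_iV+\cdots+E_dV)$ and $U_i^\Downarrow=(E_0^*V+\cdots+E_i^*V)\cap(E_0V+\cdots+E_{d-i}V)$ for $0\le i\le d$. It is known that $V=\bigoplus_i U_i=\bigoplus_i U_i^\Downarrow$ with all summands nonzero. $K,B\in\mathrm{End}(V)$ are the linear maps acting on $U_i$, respectively $U_i^\Downarrow$, as the scalar $q^{d-2i}$ ($0\le i\le d$). $\mathcal{M}=\dfrac{aK-a^{-1}B}{a-a^{-1}}\in\mathrm{End}(V)$, and $W_i=\{v\in V:\mathcal{M}v=q^{d-2i}v\}$ is the eigenspace of $\mathcal{M}$ for the eigenvalue $q^{d-2i}$ ($0\le i\le d$); $W_{-1}=0$, $W_{d+1}=0$. *)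

theory Defs
  imports "HOL-Computational_Algebra.Polynomial" "HOL-Library.Set_Algebras"
begin

text \<open>
  The vector space \<open>V\<close> is a whole type with scalar multiplication \<open>scale\<close>, and endomorphisms of \<open>V\<close>
  are linear functions on this type. Sums of subspaces are the setwise sums of
  \<^theory>\<open>HOL-Library.Set_Algebras\<close>. Families indexed by \<open>0, \<dots>, d\<close> are functions on
  \<^typ>\<open>nat\<close> whose values beyond \<open>d\<close> are irrelevant.
  The subspaces \<open>E\<^sub>iV\<close> and \<open>E\<^sub>i\<^sup>*V\<close> are the ranges of \<open>E i\<close> and \<open>Es i\<close>.
\<close>

definition padded :: "nat \<Rightarrow> (nat \<Rightarrow> 'v::zero set) \<Rightarrow> int \<Rightarrow> 'v set" where
  \<comment> \<open>implements the conventions \<open>V\<^sub>-\<^sub>1 = V\<^sub>d\<^sub>+\<^sub>1 = 0\<close>\<close>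
  "padded d V i = (if 0 \<le> i \<and> i \<le> int d then V (nat i) else {0})"

definition split_decomp :: "nat \<Rightarrow> (nat \<Rightarrow> 'v \<Rightarrow> 'v::comm_monoid_add) \<Rightarrow> (nat \<Rightarrow> 'v \<Rightarrow> 'v) \<Rightarrow> nat \<Rightarrow> 'v set" where
  "split_decomp d E Es i = (\<Sum>h\<le>i. range (Es h)) \<inter> (\<Sum>h=i..d. range (E h))"

definition split_decomp_down :: "nat \<Rightarrow> (nat \<Rightarrow> 'v \<Rightarrow> 'v::comm_monoid_add) \<Rightarrow> (nat \<Rightarrow> 'v \<Rightarrow> 'v) \<Rightarrow> nat \<Rightarrow> 'v set" where
  "split_decomp_down d E Es i = (\<Sum>h\<le>i. range (Es h)) \<inter> (\<Sum>h\<le>d - i. range (E h))"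

definition eigenspace :: "('k::field \<Rightarrow> 'v::ab_group_add \<Rightarrow> 'v) \<Rightarrow> ('v \<Rightarrow> 'v) \<Rightarrow> 'k \<Rightarrow> 'v set" where
  "eigenspace scale f c = {v. f v = scale c v}"

definition eigenspaces :: "('k::field \<Rightarrow> 'v::ab_group_add \<Rightarrow> 'v) \<Rightarrow> ('v \<Rightarrow> 'v) \<Rightarrow> 'v set set" where
  "eigenspaces scale f = {eigenspace scale f c | c. eigenspace scale f c \<noteq> {0}}"

definition diagonalizable :: "('k::field \<Rightarrow> 'v::ab_group_add \<Rightarrow> 'v) \<Rightarrow> ('v \<Rightarrow> 'v) \<Rightarrow> bool" where
  "diagonalizable scale f \<longleftrightarrow> module.span scale (\<Union> (eigenspaces scale f)) = UNIV"

definition standard_ordering :: "('k::field \<Rightarrow> 'v::ab_group_add \<Rightarrow> 'v) \<Rightarrow> ('v \<Rightarrow> 'v) \<Rightarrow> ('v \<Rightarrow> 'v) \<Rightarrow> nat \<Rightarrow> (nat \<Rightarrow> 'v set) \<Rightarrow> bool" where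
  "standard_ordering scale A As d V \<longleftrightarrow>
     bij_betw V {..d} (eigenspaces scale A) \<and>
     (\<forall>i\<le>d. As ` V i \<subseteq> padded d V (int i - 1) + V i + padded d V (int i + 1))"

definition TD_pair :: "('k::field \<Rightarrow> 'v::ab_group_add \<Rightarrow> 'v) \<Rightarrow> ('v \<Rightarrow> 'v) \<Rightarrow> ('v \<Rightarrow> 'v) \<Rightarrow> bool" where
  "TD_pair scale A As \<longleftrightarrow>
     Vector_Spaces.linear scale scale A \<and> Vector_Spaces.linear scale scale As \<and>
     diagonalizable scale A \<and> diagonalizable scale As \<and>
     (\<exists>d V. standard_ordering scale A As d V) \<and>
     (\<exists>d Vs. standard_ordering scale As A d Vs) \<and>
     \<not> (\<exists>W. module.subspace scale W \<and> W \<noteq> {0} \<and> W \<noteq> UNIV \<and> A ` W \<subseteq> W \<and> As ` W \<subseteq> W)"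

definition primitive_idempotent :: "('k::field \<Rightarrow> 'v::ab_group_add \<Rightarrow> 'v) \<Rightarrow> ('v \<Rightarrow> 'v) \<Rightarrow> 'v set \<Rightarrow> ('v \<Rightarrow> 'v) \<Rightarrow> bool" where
  "primitive_idempotent scale A W E \<longleftrightarrow>
     W \<in> eigenspaces scale A \<and> Vector_Spaces.linear scale scale E \<and>
     (\<forall>v\<in>W. E v = v) \<and> (\<forall>W'\<in>eigenspaces scale A - {W}. \<forall>v\<in>W'. E v = 0)"

definition TD_system :: "('k::field \<Rightarrow> 'v::ab_group_add \<Rightarrow> 'v) \<Rightarrow> nat \<Rightarrow> ('v \<Rightarrow> 'v) \<Rightarrow> (nat \<Rightarrow> 'v \<Rightarrow> 'v) \<Rightarrow> ('v \<Rightarrow> 'v) \<Rightarrow> (nat \<Rightarrow> 'v \<Rightarrow> 'v) \<Rightarrow> bool" where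
  "TD_system scale d A E As Es \<longleftrightarrow>
     TD_pair scale A As \<and>
     (\<forall>i\<le>d. primitive_idempotent scale A (range (E i)) (E i)) \<and>
     (\<forall>i\<le>d. primitive_idempotent scale As (range (Es i)) (Es i)) \<and>
     standard_ordering scale A As d (\<lambda>i. range (E i)) \<and>
     standard_ordering scale As A d (\<lambda>i. range (Es i))"

definition q_Racah_type_with ::
  "('k::field \<Rightarrow> 'v::ab_group_add \<Rightarrow> 'v) \<Rightarrow> nat \<Rightarrow> ('v \<Rightarrow> 'v) \<Rightarrow> (nat \<Rightarrow> 'v \<Rightarrow> 'v) \<Rightarrow> ('v \<Rightarrow> 'v) \<Rightarrow> (nat \<Rightarrow> 'v \<Rightarrow> 'v) \<Rightarrow> 'k \<Rightarrow> 'k \<Rightarrow> 'k \<Rightarrow> bool" where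
  \<comment> \<open>an eigenvalue \<open>\<theta>\<^sub>i\<close> is specified by its eigenspace being the range of \<open>E\<^sub>i\<close>\<close>
  "q_Racah_type_with scale d A E As Es q a b \<longleftrightarrow>
     q \<noteq> 0 \<and> a \<noteq> 0 \<and> b \<noteq> 0 \<and> q ^ 4 \<noteq> 1 \<and>
     (\<forall>i\<le>d. range (E i) =
        eigenspace scale A (a * q powi (int d - 2 * int i) + inverse a * q powi (2 * int i - int d))) \<and>
     (\<forall>i\<le>d. range (Es i) =
        eigenspace scale As (b * q powi (int d - 2 * int i) + inverse b * q powi (2 * int i - int d)))"

definition acts_on_split :: "('k::field \<Rightarrow> 'v::ab_group_add \<Rightarrow> 'v) \<Rightarrow> nat \<Rightarrow> 'k \<Rightarrow> (nat \<Rightarrow> 'v set) \<Rightarrow> ('v \<Rightarrow> 'v) \<Rightarrow> bool" where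
  \<comment> \<open>determines \<open>K\<close> uniquely when the \<open>U\<^sub>i\<close> sum to the whole space\<close>
  "acts_on_split scale d q U K \<longleftrightarrow>
     Vector_Spaces.linear scale scale K \<and>
     (\<forall>i\<le>d. \<forall>u\<in>U i. K u = scale (q powi (int d - 2 * int i)) u)"

definition M_map :: "('k::field \<Rightarrow> 'v::ab_group_add \<Rightarrow> 'v) \<Rightarrow> 'k \<Rightarrow> ('v \<Rightarrow> 'v) \<Rightarrow> ('v \<Rightarrow> 'v) \<Rightarrow> 'v \<Rightarrow> 'v" where
  "M_map scale a K B v = scale (inverse (a - inverse a)) (scale a (K v) - scale (inverse a) (B v))"

definition M_eigenspace :: "('k::field \<Rightarrow> 'v::ab_group_add \<Rightarrow> 'v) \<Rightarrow> nat \<Rightarrow> 'k \<Rightarrow> 'k \<Rightarrow> ('v \<Rightarrow> 'v) \<Rightarrow> ('v \<Rightarrow> 'v) \<Rightarrow> nat \<Rightarrow> 'v set" where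
  "M_eigenspace scale d q a K B i = eigenspace scale (M_map scale a K B) (q powi (int d - 2 * int i))"

end

(*
  Put F_i = E*_0 V + ... + E*_i V, t = q^2, S = a K - a^-1 B (so M = S / (a - a^-1)), D = K - B and
  P = (a - a^-1) A - a^2 K + a^-2 B.  Then (a - a^-1) (A - (a + a^-1) M) = P - D, so it suffices that
  D maps W_i into W_{i-1} and P maps W_i into W_{i+1}.  Both shifts, S D = t D S and t S P = P S,
  are equivalent to one quadratic relation C = 0 between K and B.

  To see that C = 0: C lowers the flag F and satisfies a homogeneous linear relation with A, by which
  t^2 C A - A C lowers F at least as far as C does.  Since F is opposite to both
  flags E_i V + ... + E_d V and E_0 V + ... + E_{d-i} V, the powers A^(d-2i) induce isomorphisms
  F_i / F_{i-1} -> F_{d-i} / F_{d-i-1}, as for sl_2.  An operator commuting up to scalars with such an A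
  cannot have a negative degree, so C lowers F by arbitrarily many steps.

  The eigenvalue t^-1 q^-d of M on P W_d may coincide with q^d, as q^(2d+2) = 1 is not excluded;
  hence P W_d = 0 needs a separate argument.
*)
theory Submission
  imports Defs
begin

section \<open>Endomorphisms and flags of a tridiagonal pair\<close>

locale endo_space = vector_space scale
  for scale :: "'k::field \<Rightarrow> 'v::ab_group_add \<Rightarrow> 'v"
begin

abbreviation endo :: "('v \<Rightarrow> 'v) \<Rightarrow> bool" where
  "endo \<equiv> Vector_Spaces.linear scale scale"

lemma endoI:
  assumes "\<And>x y. f (x + y) = f x + f y" and "\<And>c x. f (scale c x) = scale c (f x)"
  shows "endo f"
  using assms vector_space_axioms by (simp add: Vector_Spaces.linear_iff vector_space_def)

lemma endo_add: "endo f \<Longrightarrow> f (x + y) = f x + f y"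
  and endo_scale: "endo f \<Longrightarrow> f (scale c x) = scale c (f x)"
  by (auto simp: Vector_Spaces.linear_iff)

lemma endo_zero: "endo f \<Longrightarrow> f 0 = 0"
  using endo_scale[of f 0 0] by simp

lemma endo_diff: "endo f \<Longrightarrow> f (x - y) = f x - f y"
  using endo_add[of f "x - y" y] by (simp add: algebra_simps)

lemmas endo_simps = endo_add endo_scale endo_zero endo_diff

lemma endo_span_into:
  assumes "endo f" "subspace T" "\<And>x. x \<in> S \<Longrightarrow> f x \<in> T" "v \<in> span S"
  shows "f v \<in> T"
  using assms(4)
proof (induction rule: span_induct)
  case base
  show ?case
    using assms(1,2) by (auto simp: subspace_def endo_simps)
qed (use assms(3) in auto)

lemma endo_funpow: "endo f \<Longrightarrow> endo (f ^^ k)"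
  by (rule endoI; induction k) (simp_all add: endo_simps)

lemma endo_shift: "endo f \<Longrightarrow> endo (\<lambda>v. f v - scale c v)"
  by (rule endoI) (simp_all add: endo_simps algebra_simps)

lemma subspace_scale_cancel:
  assumes "subspace T" "c \<noteq> 0" "scale c y \<in> T"
  shows "y \<in> T"
  using subspace_scale[OF assms(1,3), of "inverse c"] assms(2) by simp

lemma subspace_cancel:
  assumes "subspace T" "c \<noteq> 0" "x \<in> T" "x - scale c y \<in> T"
  shows "y \<in> T"
  using subspace_scale_cancel[OF assms(1,2)] subspace_diff[OF assms(1,3,4)] by (simp add: algebra_simps)

text \<open>A polynomial in \<open>f\<close> given by the list of its roots, so that it can be
  handled factor by factor. It is used for \<open>A\<close> and its eigenvalues, and later for
  \<open>S\<close>.\<close>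

definition shifts :: "('v \<Rightarrow> 'v) \<Rightarrow> (nat \<Rightarrow> 'k) \<Rightarrow> nat list \<Rightarrow> 'v \<Rightarrow> 'v" where
  "shifts f c js = foldr (\<lambda>j v. f v - scale (c j) v) js"

lemma shifts_simps [simp]: "shifts f c [] v = v"
    "shifts f c (j # js) v = f (shifts f c js v) - scale (c j) (shifts f c js v)"
  by (simp_all add: shifts_def)

lemma shifts_append: "shifts f c (is @ js) v = shifts f c is (shifts f c js v)"
  by (simp add: shifts_def)

lemma endo_shifts: "endo f \<Longrightarrow> endo (shifts f c js)"
  by (rule endoI; induction js) (simp_all add: endo_simps algebra_simps)

lemma shifts_commute:
  assumes "endo f"
  shows "shifts f c js (f v - scale b v) = f (shifts f c js v) - scale b (shifts f c js v)"
proof (induction js)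
  case (Cons j js)
  show ?case
    unfolding shifts_simps Cons by (simp add: endo_simps[OF assms] algebra_simps)
qed simp

lemma shifts_eigenvector:
  "endo f \<Longrightarrow> f v = scale m v \<Longrightarrow> shifts f c js v = scale (\<Prod>j\<leftarrow>js. m - c j) v"
  by (induction js) (simp_all add: endo_simps algebra_simps)

text \<open>Sums of subspaces are encoded as spans, so that a linear map is controlled by its values
  on the members, for any index set.\<close>

definition sum_span :: "(nat \<Rightarrow> 'v set) \<Rightarrow> nat set \<Rightarrow> 'v set" where
  "sum_span X J = span (\<Union> (X ` J))"

lemma subspace_sum_span [simp]: "subspace (sum_span X J)"
  by (simp add: sum_span_def)

lemma sum_span_mono: "I \<subseteq> J \<Longrightarrow> sum_span X I \<subseteq> sum_span X J"
  unfolding sum_span_def by (intro span_mono) auto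

lemma sum_span_base: "h \<in> J \<Longrightarrow> v \<in> X h \<Longrightarrow> v \<in> sum_span X J"
  unfolding sum_span_def by (intro span_base) auto

lemma endo_sum_span_into:
  assumes "endo f" "subspace T" "\<And>h x. h \<in> J \<Longrightarrow> x \<in> X h \<Longrightarrow> f x \<in> T" "v \<in> sum_span X J"
  shows "f v \<in> T"
  using assms endo_span_into[of f T "\<Union> (X ` J)" v] unfolding sum_span_def by blast

lemma sum_span_Un: "v \<in> sum_span X (I \<union> J) \<Longrightarrow> \<exists>x\<in>sum_span X I. \<exists>y\<in>sum_span X J. v = x + y"
  unfolding sum_span_def image_Un Union_Un_distrib span_Un by blast

end

section \<open>The two opposite flags and the split decomposition between them\<close>

text \<open>
  \<open>X h\<close> and \<open>Y h\<close> stand for \<open>E\<^sup>*\<^sub>hV\<close> and \<open>E\<^sub>hV\<close>. Only the half of each tridiagonality condition that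
  the flags below need is assumed, and flags and eigenvalues are indexed by integers, which removes all boundary cases.
\<close>
locale td_flags = endo_space scale
  for scale :: "'k::field \<Rightarrow> 'v::ab_group_add \<Rightarrow> 'v" +
  fixes A As :: "'v \<Rightarrow> 'v" and X Y :: "nat \<Rightarrow> 'v set" and th ths :: "int \<Rightarrow> 'k" and d :: nat
  assumes endo_A: "endo A" and endo_As: "endo As"
    and A_Y: "\<And>h v. h \<le> d \<Longrightarrow> v \<in> Y h \<Longrightarrow> A v = scale (th (int h)) v"
    and As_X: "\<And>h v. h \<le> d \<Longrightarrow> v \<in> X h \<Longrightarrow> As v = scale (ths (int h)) v"
    and A_X: "\<And>h v. h \<le> d \<Longrightarrow> v \<in> X h \<Longrightarrow> A v \<in> sum_span X {l. l \<le> d \<and> int l \<le> int h + 1}"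
    and As_Y: "\<And>h v. h \<le> d \<Longrightarrow> v \<in> Y h \<Longrightarrow> As v \<in> sum_span Y {l. l \<le> d \<and> int h - 1 \<le> int l}"
    and X_span: "sum_span X {..d} = UNIV"
    and Y_span: "sum_span Y {..d} = UNIV"
    and Y_proper: "sum_span Y {1..d} \<noteq> UNIV"
    and X_0: "\<exists>v\<in>X 0. v \<noteq> 0"
    and irreducible: "\<And>W. subspace W \<Longrightarrow> A ` W \<subseteq> W \<Longrightarrow> As ` W \<subseteq> W \<Longrightarrow> W = {0} \<or> W = UNIV"
begin

text \<open>For \<open>0 \<le> i \<le> d\<close> the split summand \<open>U_i\<close> is
  \<open>F i \<inter> G i\<close>.\<close>

definition F :: "int \<Rightarrow> 'v set" where
  "F i = sum_span X {h. h \<le> d \<and> int h \<le> i}"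

definition G :: "int \<Rightarrow> 'v set" where
  "G i = sum_span Y {h. h \<le> d \<and> i \<le> int h}"

lemma subspace_F [simp]: "subspace (F i)" and subspace_G [simp]: "subspace (G i)"
  by (simp_all add: F_def G_def)

lemma F_mono: "v \<in> F i \<Longrightarrow> i \<le> j \<Longrightarrow> v \<in> F j"
  unfolding F_def using sum_span_mono[of "{h. h \<le> d \<and> int h \<le> i}" "{h. h \<le> d \<and> int h \<le> j}"] by force

lemma G_antimono: "v \<in> G j \<Longrightarrow> i \<le> j \<Longrightarrow> v \<in> G i"
  unfolding G_def using sum_span_mono[of "{h. h \<le> d \<and> j \<le> int h}" "{h. h \<le> d \<and> i \<le> int h}"] by force

lemma F_neg: "i < 0 \<Longrightarrow> F i = {0}"
  by (simp add: F_def sum_span_def)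

lemma F_top: "int d \<le> i \<Longrightarrow> F i = UNIV"
proof -
  assume "int d \<le> i"
  then have "{h. h \<le> d \<and> int h \<le> i} = {..d}" by auto
  then show ?thesis by (simp add: F_def X_span)
qed

lemma G_bot: "i \<le> 0 \<Longrightarrow> G i = UNIV"
proof -
  assume "i \<le> 0"
  then have "{h. h \<le> d \<and> i \<le> int h} = {..d}" by auto
  then show ?thesis by (simp add: G_def Y_span)
qed

lemma G_top: "int d < i \<Longrightarrow> G i = {0}"
proof -
  assume "int d < i"
  then have "{h. h \<le> d \<and> i \<le> int h} = {}" by auto
  then show ?thesis unfolding G_def sum_span_def by (simp only: image_empty Union_empty span_empty)
qed

lemma A_F: "v \<in> F i \<Longrightarrow> A v \<in> F (i + 1)"
  unfolding F_def
proof (erule endo_sum_span_into[rotated -1], rule endo_A)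
  fix h x assume h: "h \<in> {h. h \<le> d \<and> int h \<le> i}" "x \<in> X h"
  then have "A x \<in> sum_span X {l. l \<le> d \<and> int l \<le> int h + 1}" by (intro A_X) auto
  also have "\<dots> \<subseteq> sum_span X {h. h \<le> d \<and> int h \<le> i + 1}"
    using h by (intro sum_span_mono) auto
  finally show "A x \<in> sum_span X {h. h \<le> d \<and> int h \<le> i + 1}" .
qed simp

lemma As_F: "v \<in> F i \<Longrightarrow> As v - scale (ths i) v \<in> F (i - 1)"
  unfolding F_def
proof (erule endo_sum_span_into[rotated -1], rule endo_shift[OF endo_As])
  fix h x assume h: "h \<in> {h. h \<le> d \<and> int h \<le> i}" "x \<in> X h"
  show "As x - scale (ths i) x \<in> sum_span X {h. h \<le> d \<and> int h \<le> i - 1}"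
  proof (cases "int h = i")
    case True
    then show ?thesis using h As_X by (simp add: subspace_0)
  next
    case False
    then have "x \<in> sum_span X {h. h \<le> d \<and> int h \<le> i - 1}"
      using h by (intro sum_span_base[of h]) auto
    then show ?thesis using h As_X by (auto intro!: subspace_diff subspace_scale)
  qed
qed simp

lemma As_G: "v \<in> G i \<Longrightarrow> As v \<in> G (i - 1)"
  unfolding G_def
proof (erule endo_sum_span_into[rotated -1], rule endo_As)
  fix h x assume h: "h \<in> {h. h \<le> d \<and> i \<le> int h}" "x \<in> Y h"
  then have "As x \<in> sum_span Y {l. l \<le> d \<and> int h - 1 \<le> int l}" by (intro As_Y) auto
  also have "\<dots> \<subseteq> sum_span Y {h. h \<le> d \<and> i - 1 \<le> int h}"
    using h by (intro sum_span_mono) auto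
  finally show "As x \<in> sum_span Y {h. h \<le> d \<and> i - 1 \<le> int h}" .
qed simp

lemma A_G: "v \<in> G i \<Longrightarrow> A v - scale (th i) v \<in> G (i + 1)"
  unfolding G_def
proof (erule endo_sum_span_into[rotated -1], rule endo_shift[OF endo_A])
  fix h x assume h: "h \<in> {h. h \<le> d \<and> i \<le> int h}" "x \<in> Y h"
  show "A x - scale (th i) x \<in> sum_span Y {h. h \<le> d \<and> i + 1 \<le> int h}"
  proof (cases "int h = i")
    case True
    then show ?thesis using h A_Y by (simp add: subspace_0)
  next
    case False
    then have "x \<in> sum_span Y {h. h \<le> d \<and> i + 1 \<le> int h}"
      using h by (intro sum_span_base[of h]) auto
    then show ?thesis using h A_Y by (auto intro!: subspace_diff subspace_scale)
  qed
qed simp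

lemma A_F_shift: "v \<in> F i \<Longrightarrow> A v - scale c v \<in> F (i + 1)"
  using A_F[of v i] F_mono[of v i "i + 1"] by (auto intro!: subspace_diff subspace_scale)

lemma As_G_shift: "v \<in> G i \<Longrightarrow> As v - scale c v \<in> G (i - 1)"
  using As_G[of v i] G_antimono[of v i "i - 1"] by (auto intro!: subspace_diff subspace_scale)

definition diagonal :: "int \<Rightarrow> 'v set" where
  "diagonal r = span (\<Union>i. F i \<inter> G (i + r))"

text \<open>
  \<open>A\<close> and \<open>A\<^sup>*\<close> shift \<open>F i \<inter> G (i + r)\<close> by one step along the diagonal, so irreducibility applies: the
  diagonal \<open>r = 1\<close> lies in a proper subspace, whereas the diagonal \<open>r = 0\<close> is nonzero.
\<close>
lemma diagonal_trivial: "diagonal r = {0} \<or> diagonal r = UNIV"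
proof (rule irreducible)
  show "subspace (diagonal r)" by (simp add: diagonal_def)
next
  have "A v \<in> diagonal r" if "v \<in> diagonal r" for v
    using that[unfolded diagonal_def]
  proof (rule endo_span_into[rotated -1, OF _ endo_A])
    fix x assume "x \<in> (\<Union>i. F i \<inter> G (i + r))"
    then obtain i where x: "x \<in> F i" "x \<in> G (i + r)" by auto
    then have "A x - scale (th (i + r)) x \<in> F (i + 1) \<inter> G (i + 1 + r)"
      using A_F_shift[OF x(1)] A_G[OF x(2)] by (simp add: algebra_simps)
    then have "A x - scale (th (i + r)) x \<in> diagonal r"
      unfolding diagonal_def by (intro span_base) blast
    moreover have "x \<in> diagonal r"
      unfolding diagonal_def using x by (intro span_base) blast
    ultimately have "(A x - scale (th (i + r)) x) + scale (th (i + r)) x \<in> diagonal r"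
      unfolding diagonal_def by (intro span_add span_scale)
    then show "A x \<in> diagonal r" by simp
  qed (simp add: diagonal_def)
  then show "A ` diagonal r \<subseteq> diagonal r" by blast
next
  have "As v \<in> diagonal r" if "v \<in> diagonal r" for v
    using that[unfolded diagonal_def]
  proof (rule endo_span_into[rotated -1, OF _ endo_As])
    fix x assume "x \<in> (\<Union>i. F i \<inter> G (i + r))"
    then obtain i where x: "x \<in> F i" "x \<in> G (i + r)" by auto
    then have "As x - scale (ths i) x \<in> F (i - 1) \<inter> G (i - 1 + r)"
      using As_F[OF x(1)] As_G_shift[OF x(2)] by (simp add: algebra_simps)
    then have "As x - scale (ths i) x \<in> diagonal r"
      unfolding diagonal_def by (intro span_base) blast
    moreover have "x \<in> diagonal r"
      unfolding diagonal_def using x by (intro span_base) blast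
    ultimately have "(As x - scale (ths i) x) + scale (ths i) x \<in> diagonal r"
      unfolding diagonal_def by (intro span_add span_scale)
    then show "As x \<in> diagonal r" by simp
  qed (simp add: diagonal_def)
  then show "As ` diagonal r \<subseteq> diagonal r" by blast
qed

text \<open>Such a vector lies on the diagonal \<open>r = 1\<close>. The pieces of that diagonal
  vanish for \<open>k < 0\<close> and lie in \<open>G 1\<close> otherwise, and \<open>G 1\<close> is
  proper.\<close>

lemma F_Int_G: 
  assumes "v \<in> F i" "v \<in> G j" "i < j"
  shows "v = 0"
proof -
  have "F k \<inter> G (k + 1) \<subseteq> G 1" for k
    using F_neg[of k] G_antimono[of _ "k + 1" 1] by (cases "k < 0") (auto simp: subspace_0)
  then have "diagonal 1 \<subseteq> G 1"
    unfolding diagonal_def by (intro span_minimal) auto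
  moreover have "{h. h \<le> d \<and> 1 \<le> int h} = {1..d}" by auto
  then have "G 1 \<noteq> UNIV" using Y_proper by (simp add: G_def)
  ultimately have "diagonal 1 = {0}" using diagonal_trivial[of 1] by blast
  moreover have "v \<in> diagonal 1"
    unfolding diagonal_def using assms G_antimono[of v j "i + 1"] by (intro span_base) auto
  ultimately show ?thesis by simp
qed

lemma diagonal_0: "diagonal 0 = UNIV"
proof -
  obtain v where v: "v \<in> X 0" "v \<noteq> 0" using X_0 by blast
  have "v \<in> F 0 \<inter> G 0"
    using v G_bot[of 0] by (auto simp: F_def intro: sum_span_base[of 0])
  then have "v \<in> diagonal 0" unfolding diagonal_def by (intro span_base) auto
  then show ?thesis using v diagonal_trivial[of 0] by blast
qed

text \<open>The diagonal \<open>r = 0\<close> is the whole space, and its pieces with index outside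
  \<open>0, ..., d\<close> vanish.\<close>

lemma split_induct:
  assumes "endo f" "subspace T" "\<And>i v. 0 \<le> i \<Longrightarrow> i \<le> int d \<Longrightarrow> v \<in> F i \<Longrightarrow> v \<in> G i \<Longrightarrow> f v \<in> T"
  shows "f v \<in> T"
proof (rule endo_span_into[OF assms(1,2)])
  show "v \<in> span (\<Union>i. F i \<inter> G (i + 0))" using diagonal_0 by (simp add: diagonal_def)
  fix x assume "x \<in> (\<Union>i. F i \<inter> G (i + 0))"
  then obtain i where x: "x \<in> F i" "x \<in> G i" by auto
  show "f x \<in> T"
  proof (cases "0 \<le> i \<and> i \<le> int d")
    case False
    then have "x = 0" using x F_neg[of i] G_top[of i] by (cases "i < 0") auto
    then show ?thesis using assms(1,2) by (simp add: endo_zero subspace_0)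
  qed (use x assms(3) in auto)
qed

text \<open>Split summands with index below \<open>i\<close> lie in the first term, all others in
  the second. Together with \<open>F_Int_G\<close> this makes the flags opposite.\<close>

lemma F_plus_G: "\<exists>x\<in>F (i - 1). \<exists>y\<in>G i. v = x + y"
proof -
  let ?T = "{x + y | x y. x \<in> F (i - 1) \<and> y \<in> G i}"
  have "v \<in> ?T"
  proof (rule split_induct[of "\<lambda>v. v"])
    show "endo (\<lambda>v. v)" by (rule endoI) auto
    show "subspace ?T" by (rule subspace_sums) simp_all
    fix j x assume x: "x \<in> F j" "x \<in> G j"
    show "x \<in> ?T"
    proof (cases "j < i")
      case True
      then have "x \<in> F (i - 1)" "0 \<in> G i" using F_mono[OF x(1)] by (auto simp: subspace_0)
      then show ?thesis by force
    next
      case False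
      then have "x \<in> G i" "0 \<in> F (i - 1)" using G_antimono[OF x(2)] by (auto simp: subspace_0)
      then show ?thesis by force
    qed
  qed
  then show ?thesis by blast
qed

lemma F_decomp:
  assumes "v \<in> F i"
  obtains u f where "u \<in> F i" "u \<in> G i" "f \<in> F (i - 1)" "v = u + f"
proof -
  obtain f u where fu: "f \<in> F (i - 1)" "u \<in> G i" "v = f + u" using F_plus_G by blast
  then have "u = v - f" by simp
  also have "\<dots> \<in> F i" using assms fu(1) F_mono[of f "i - 1" i] by (intro subspace_diff) auto
  finally show thesis using fu that[of u f] by (simp add: add.commute)
qed

end

section \<open>The map acting as a geometric progression on a split decomposition\<close>

text \<open>With \<open>a'\<close> for the inverse of \<open>a\<close>, reversing the order of the
  eigenvalues swaps \<open>a\<close> and \<open>a'\<close>. One locale therefore serves both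
  \<open>K\<close> and \<open>B\<close>.\<close>

locale q_split = td_flags scale A As X Y th ths d
  for scale :: "'k::field \<Rightarrow> 'v::ab_group_add \<Rightarrow> 'v" and A As X Y th ths d +
  fixes q a a' :: 'k and K :: "'v \<Rightarrow> 'v"
  assumes q_nonzero: "q \<noteq> 0" and a_inverse: "a * a' = 1"
    and th_eq: "\<And>i. th i = a * q powi (int d - 2 * i) + a' * inverse (q powi (int d - 2 * i))"
    and endo_K: "endo K"
    and K_U: "\<And>i v. 0 \<le> i \<Longrightarrow> i \<le> int d \<Longrightarrow> v \<in> F i \<Longrightarrow> v \<in> G i \<Longrightarrow>
      K v = scale (q powi (int d - 2 * i)) v"
begin

definition ev :: "int \<Rightarrow> 'k" where "ev i = q powi (int d - 2 * i)"

lemma ev_nonzero: "ev i \<noteq> 0"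
  by (simp add: ev_def q_nonzero)

lemma ev_Suc: "q\<^sup>2 * ev (i + 1) = ev i"
proof -
  have "q powi 2 * q powi (int d - 2 * (i + 1)) = q powi (int d - 2 * i)"
    using q_nonzero by (subst power_int_add [symmetric]) auto
  then show ?thesis by (simp add: ev_def)
qed

text \<open>\<open>K\<close> is the right scalar on the representative from \<open>F_decomp\<close>,
  so only the remainder in \<open>F (i - 1)\<close> matters. The assumption on it is supplied by the
  induction in \<open>K_F\<close>, which starts from the zero space at
  \<open>i = -1\<close>.\<close>

lemma K_F_aux:
  assumes "v \<in> F i" and K_le: "\<And>f. f \<in> F (i - 1) \<Longrightarrow> K f \<in> F (i - 1)"
  shows "K v - scale (ev i) v \<in> F (i - 1)"
proof -
  consider "i < 0" | "0 \<le> i" "i \<le> int d" | "int d < i" by linarith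
  then show ?thesis
  proof cases
    case 1
    then show ?thesis using assms(1) by (simp add: F_neg endo_zero[OF endo_K])
  next
    case 2
    obtain u f where uf: "u \<in> F i" "u \<in> G i" "f \<in> F (i - 1)" "v = u + f"
      using assms(1) by (rule F_decomp)
    then have "K v - scale (ev i) v = K f - scale (ev i) f"
      using K_U[of i u] 2 by (simp add: endo_add[OF endo_K] ev_def algebra_simps)
    then show ?thesis using uf K_le by (auto intro!: subspace_diff subspace_scale)
  next
    case 3
    then show ?thesis by (simp add: F_top)
  qed
qed

lemma K_F: "v \<in> F i \<Longrightarrow> K v \<in> F i"
proof (cases "i < 0")
  case True
  then show "v \<in> F i \<Longrightarrow> K v \<in> F i" by (simp add: F_neg endo_zero[OF endo_K])
next
  case False
  then have "- 1 \<le> i" by simp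
  then show "v \<in> F i \<Longrightarrow> K v \<in> F i"
  proof (induction i arbitrary: v rule: int_ge_induct)
    case base
    then show ?case by (simp add: F_neg endo_zero[OF endo_K])
  next
    case (step i)
    then have "K v - scale (ev (i + 1)) v \<in> F (i + 1)"
      using K_F_aux[of v "i + 1"] F_mono[of _ i "i + 1"] by simp
    then have "(K v - scale (ev (i + 1)) v) + scale (ev (i + 1)) v \<in> F (i + 1)"
      using step.prems by (intro subspace_add subspace_scale) simp_all
    then show ?case by simp
  qed
qed

lemma K_F_shift: "v \<in> F i \<Longrightarrow> K v - scale (ev i) v \<in> F (i - 1)"
  by (rule K_F_aux [OF _ K_F])

lemma A_top: "v \<in> G (int d) \<Longrightarrow> A v = scale (th (int d)) v"
  using A_G[of v "int d"] G_top[of "int d + 1"] by simp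

text \<open>On the split summand of index \<open>i\<close>, \<open>A\<close> is \<open>th i\<close>
  plus a part \<open>r\<close> in the next summand. The terms in \<open>r\<close> cancel because
  \<open>q\<^sup>2 * ev (i + 1) = ev i\<close>, those in \<open>v\<close> because
  \<open>th i * ev i = a * (ev i * ev i) + a'\<close>.\<close>

lemma K_A: "scale (q\<^sup>2) (K (A v)) = A (K v) + scale (q\<^sup>2 - 1) (scale a (K (K v)) + scale a' v)"
proof -
  note A = endo_simps[OF endo_A] and K = endo_simps[OF endo_K]
  let ?f = "\<lambda>v. scale (q\<^sup>2) (K (A v)) - (A (K v) + scale (q\<^sup>2 - 1) (scale a (K (K v)) + scale a' v))"
  have "?f v \<in> {0}"
  proof (rule split_induct[of ?f])
    show "endo ?f" by (rule endoI) (simp_all add: A K algebra_simps)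
  next
    fix i v assume i: "0 \<le> i" "i \<le> int d" and v: "v \<in> F i" "v \<in> G i"
    define r where "r = A v - scale (th i) v"
    have r: "r \<in> F (i + 1)" "r \<in> G (i + 1)"
      using A_F_shift[OF v(1)] A_G[OF v(2)] by (simp_all add: r_def)
    have Kr: "K r = scale (ev (i + 1)) r"
    proof (cases "i = int d")
      case True
      then have "r = 0" using r G_top[of "i + 1"] by simp
      then show ?thesis by (simp add: K)
    next
      case False
      then show ?thesis using K_U[of "i + 1" r] i r by (simp add: ev_def)
    qed
    have Av: "A v = scale (th i) v + r" by (simp add: r_def)
    have Kv: "K v = scale (ev i) v" using K_U i v by (simp add: ev_def)
    have "scale (q\<^sup>2) (K (A v)) = scale (q\<^sup>2 * (th i * ev i)) v + scale (q\<^sup>2 * ev (i + 1)) r"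
      by (simp add: Av K Kv Kr algebra_simps)
    moreover have "A (K v) + scale (q\<^sup>2 - 1) (scale a (K (K v)) + scale a' v)
      = scale (ev i * th i + (q\<^sup>2 - 1) * (a * (ev i * ev i) + a')) v + scale (ev i) r"
      by (simp add: Av A Kv K algebra_simps)
    moreover have "th i * ev i = a * (ev i * ev i) + a'"
      using ev_nonzero[of i] by (simp add: th_eq ev_def field_simps)
    then have "q\<^sup>2 * (th i * ev i) = ev i * th i + (q\<^sup>2 - 1) * (a * (ev i * ev i) + a')"
      by (simp add: algebra_simps)
    ultimately show "?f v \<in> {0}" by (simp add: ev_Suc)
  qed simp
  then show ?thesis by simp
qed

end

section \<open>Two split decompositions and the Lefschetz property\<close>

text \<open>The second copy of \<open>td_flags\<close> reverses the eigenspaces of \<open>A\<close>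
  and shares the flag \<open>F\<close>; the split summands between \<open>F\<close> and
  \<open>down.G\<close> are those on which \<open>B\<close> will be scalar.\<close>

locale two_splits =
  up: td_flags scale A As X Y th ths d +
  down: td_flags scale A As X "\<lambda>h. Y (d - h)" "\<lambda>j. th (int d - j)" ths d
  for scale :: "'k::field \<Rightarrow> 'v::ab_group_add \<Rightarrow> 'v" and A As X Y th ths d +
  fixes E :: "nat \<Rightarrow> 'v \<Rightarrow> 'v"
  assumes endo_E: "\<And>h. h \<le> d \<Longrightarrow> up.endo (E h)"
    and E_same: "\<And>h v. h \<le> d \<Longrightarrow> v \<in> Y h \<Longrightarrow> E h v = v"
    and E_other: "\<And>h l v. h \<le> d \<Longrightarrow> l \<le> d \<Longrightarrow> h \<noteq> l \<Longrightarrow> v \<in> Y h \<Longrightarrow> E l v = 0"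
    and th_inj: "\<And>h l. h \<le> d \<Longrightarrow> l \<le> d \<Longrightarrow> th (int h) = th (int l) \<Longrightarrow> h = l"
begin

abbreviation "F \<equiv> up.F"

lemma down_G_eq: "down.G j = up.sum_span Y {h. h \<le> d \<and> int h \<le> int d - j}"
proof -
  have "(\<lambda>h. Y (d - h)) ` {h. h \<le> d \<and> j \<le> int h} = Y ` {h. h \<le> d \<and> int h \<le> int d - j}"
  proof (intro equalityI subsetI)
    fix Z assume "Z \<in> Y ` {h. h \<le> d \<and> int h \<le> int d - j}"
    then obtain h where "Z = Y h" "h \<le> d" "int h \<le> int d - j" by blast
    then show "Z \<in> (\<lambda>h. Y (d - h)) ` {h. h \<le> d \<and> j \<le> int h}"
      by (intro image_eqI[of _ _ "d - h"]) auto
  qed auto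
  then show ?thesis by (simp add: down.G_def up.sum_span_def)
qed

lemma E_sum: "v = (\<Sum>h\<le>d. E h v)"
proof -
  have "v - (\<Sum>h\<le>d. E h v) \<in> {0}"
  proof (rule up.endo_sum_span_into[of "\<lambda>v. v - (\<Sum>h\<le>d. E h v)" _ "{..d}" Y])
    show "up.endo (\<lambda>v. v - (\<Sum>h\<le>d. E h v))"
      by (rule up.endoI)
        (simp_all add: up.endo_simps[OF endo_E] sum.distrib up.scale_sum_right algebra_simps)
    fix h x assume h: "h \<in> {..d}" "x \<in> Y h"
    then have "(\<Sum>l\<le>d. E l x) = (\<Sum>l\<le>d. if l = h then x else 0)"
      by (intro sum.cong) (auto simp: E_same E_other)
    then show "x - (\<Sum>l\<le>d. E l x) \<in> {0}" using h by simp
  qed (simp_all add: up.Y_span)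
  then show ?thesis unfolding singleton_iff right_minus_eq .
qed

lemma sum_span_YI:
  assumes "J \<subseteq> {..d}" "\<And>h. h \<le> d \<Longrightarrow> h \<notin> J \<Longrightarrow> E h v = 0"
  shows "v \<in> up.sum_span Y J"
proof -
  have "E h v \<in> up.sum_span Y J" if h: "h \<le> d" for h
  proof (cases "h \<in> J")
    case True
    show ?thesis
    proof (rule up.endo_sum_span_into[of "E h" _ "{..d}" Y])
      fix l x assume "l \<in> {..d}" "x \<in> Y l"
      then show "E h x \<in> up.sum_span Y J"
        using h True E_same[of h x] E_other[of l h x] up.sum_span_base[of h J x Y]
        by (cases "l = h") (auto simp: up.subspace_0)
    qed (use h in \<open>simp_all add: endo_E up.Y_span\<close>)
  qed (use h assms(2) in \<open>simp add: up.subspace_0\<close>)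
  then have "(\<Sum>h\<le>d. E h v) \<in> up.sum_span Y J" by (intro up.subspace_sum) auto
  then show ?thesis by (subst E_sum)
qed

lemma E_sum_span_Y:
  assumes "J \<subseteq> {..d}" "l \<le> d" "l \<notin> J" "v \<in> up.sum_span Y J"
  shows "E l v = 0"
proof -
  have "E l v \<in> {0}"
    using assms by (intro up.endo_sum_span_into[of "E l" _ J Y v]) (auto simp: endo_E intro: E_other)
  then show ?thesis by simp
qed

lemma E_A: "l \<le> d \<Longrightarrow> E l (A v) = scale (th (int l)) (E l v)"
proof -
  assume l: "l \<le> d"
  have "E l (A v) - scale (th (int l)) (E l v) \<in> {0}"
  proof (rule up.endo_sum_span_into[of "\<lambda>v. E l (A v) - scale (th (int l)) (E l v)" _ "{..d}" Y])
    show "up.endo (\<lambda>v. E l (A v) - scale (th (int l)) (E l v))"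
      by (rule up.endoI)
        (simp_all add: up.endo_simps[OF endo_E[OF l]] up.endo_simps[OF up.endo_A] algebra_simps)
    fix h x assume h: "h \<in> {..d}" "x \<in> Y h"
    then show "E l (A x) - scale (th (int l)) (E l x) \<in> {0}"
      using l E_other[of h l x]
      by (cases "h = l") (auto simp: up.A_Y up.endo_simps[OF endo_E[OF l]])
  qed (simp_all add: up.Y_span)
  then show ?thesis by simp
qed

text \<open>\<open>A - th l\<close> multiplies the \<open>E h\<close> component by
  \<open>th h - th l\<close>, so it can lose only the component with index \<open>l\<close>.\<close>

lemma sum_span_Y_insert:
  assumes "J \<subseteq> {..d}" "l \<le> d" "A v - scale (th (int l)) v \<in> up.sum_span Y J"
  shows "v \<in> up.sum_span Y (insert l J)"
proof (rule sum_span_YI)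
  fix h assume h: "h \<le> d" "h \<notin> insert l J"
  have "scale (th (int h) - th (int l)) (E h v) = E h (A v - scale (th (int l)) v)"
    using h E_A[of h v] by (simp add: up.endo_simps[OF endo_E] up.scale_left_diff_distrib)
  also have "\<dots> = 0" using assms h by (intro E_sum_span_Y[of J]) auto
  finally show "E h v = 0" using th_inj[of h l] h assms(2) by auto
qed (use assms in auto)

section \<open>Powers of \<open>A\<close> between the quotients of the flag: the Lefschetz
  property\<close>

lemma A_pow_F: "v \<in> F i \<Longrightarrow> (A ^^ k) v \<in> F (i + int k)"
proof (induction k)
  case (Suc k)
  then show ?case using up.A_F[of "(A ^^ k) v" "i + int k"] by (simp add: algebra_simps)
qed simp

text \<open>\<open>A - th i\<close> takes \<open>u\<close> to the next split summand, where one step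
  fewer remains; \<open>sum_span_Y_insert\<close> then adds the index \<open>i\<close>.\<close>

lemma kernel_on_split:
  assumes "u \<in> F i" "u \<in> up.G i" "0 \<le> i" "i + int k \<le> int d" "(A ^^ k) u \<in> F (i + int k - 1)"
  shows "u \<in> up.sum_span Y {h. i \<le> int h \<and> int h < i + int k}"
  using assms
proof (induction k arbitrary: u i)
  case 0
  then have "u = 0" using up.F_Int_G[of u "i - 1" i] by simp
  then show ?case by (simp add: up.subspace_0)
next
  case (Suc k)
  let ?u = "A u - scale (th i) u"
  have u: "?u \<in> F (i + 1)" "?u \<in> up.G (i + 1)"
    using Suc.prems up.A_F_shift up.A_G by auto
  have "(A ^^ k) ?u = (A ^^ Suc k) u - scale (th i) ((A ^^ k) u)"
    by (simp add: up.endo_simps[OF up.endo_funpow[OF up.endo_A]] funpow_swap1)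
  also have "\<dots> \<in> F (i + int k)"
    using Suc.prems A_pow_F[of u i k] by (intro up.subspace_diff up.subspace_scale) simp_all
  finally have "?u \<in> up.sum_span Y {h. i + 1 \<le> int h \<and> int h < i + 1 + int k}"
    using Suc.IH[of ?u "i + 1"] u Suc.prems by simp
  then have "u \<in> up.sum_span Y (insert (nat i) {h. i + 1 \<le> int h \<and> int h < i + 1 + int k})"
    using Suc.prems by (intro sum_span_Y_insert) auto
  also have "insert (nat i) {h. i + 1 \<le> int h \<and> int h < i + 1 + int k}
    = {h. i \<le> int h \<and> int h < i + int (Suc k)}"
    using Suc.prems by auto
  finally show ?case .
qed

text \<open>By \<open>kernel_on_split\<close> the representative \<open>u0\<close> has components
  only below \<open>i + k\<close>, so it lies in \<open>down.G (d - i - k + 1)\<close>. As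
  \<open>2 * i + k \<le> d\<close>, this index exceeds \<open>i\<close>, and opposition to
  \<open>F i\<close> gives \<open>u0 = 0\<close>.\<close>

lemma lefschetz_inj:
  assumes "u \<in> F i" "(A ^^ k) u \<in> F (i + int k - 1)" "2 * i + int k \<le> int d"
  shows "u \<in> F (i - 1)"
proof (cases "i < 0")
  case True
  then show ?thesis using assms(1) by (simp add: up.F_neg)
next
  case False
  obtain u0 f where uf: "u0 \<in> F i" "u0 \<in> up.G i" "f \<in> F (i - 1)" "u = u0 + f"
    using assms(1) by (rule up.F_decomp)
  have "(A ^^ k) u0 = (A ^^ k) u - (A ^^ k) f"
    by (simp add: uf up.endo_simps[OF up.endo_funpow[OF up.endo_A]])
  also have "\<dots> \<in> F (i + int k - 1)"
    using assms(2) A_pow_F[OF uf(3), of k] by (intro up.subspace_diff) (simp_all add: algebra_simps)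
  finally have "u0 \<in> up.sum_span Y {h. i \<le> int h \<and> int h < i + int k}"
    using uf False assms by (intro kernel_on_split) auto
  also have "\<dots> \<subseteq> down.G (int d - i - int k + 1)"
    unfolding down_G_eq using assms False by (intro up.sum_span_mono) auto
  finally have "u0 = 0" using down.F_Int_G[of u0 i] uf(1) assms(3) by auto
  then show ?thesis using uf by simp
qed

abbreviation "A_shifts \<equiv> up.shifts A (\<lambda>j. th (int j))"

text \<open>The scalars in the factors contribute only in lower degree, so on quotients of the flag
  the product acts as the power.\<close>

lemma shifts_F:
  assumes "v \<in> F i" shows "A_shifts js v - (A ^^ length js) v \<in> F (i + int (length js) - 1)"
proof (induction js)
  case Nil
  then show ?case by (simp add: up.subspace_0)
next
  case (Cons j js)
  let ?n = "length js"
  have *: "A_shifts js v - (A ^^ ?n) v \<in> F (i + int ?n)"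
    using Cons by (rule up.F_mono) simp
  have "A_shifts js v = (A_shifts js v - (A ^^ ?n) v) + (A ^^ ?n) v" by simp
  also have "\<dots> \<in> F (i + int ?n)"
    using * A_pow_F[OF assms, of ?n] by (intro up.subspace_add) simp_all
  finally have "A_shifts js v \<in> F (i + int ?n)" .
  moreover have "A (A_shifts js v - (A ^^ ?n) v) \<in> F (i + int ?n)"
    using up.A_F[OF Cons] by simp
  ultimately have "A (A_shifts js v - (A ^^ ?n) v) - scale (th (int j)) (A_shifts js v) \<in> F (i + int ?n)"
    by (intro up.subspace_diff up.subspace_scale) simp_all
  then show ?case by (simp add: up.endo_simps[OF up.endo_A] algebra_simps)
qed

lemma A_shift_sum_span:
  assumes "J \<subseteq> {..d}" "l \<le> d" "v \<in> up.sum_span Y J"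
  shows "A v - scale (th (int l)) v \<in> up.sum_span Y (J - {l})"
proof (rule up.endo_sum_span_into[OF up.endo_shift[OF up.endo_A] _ _ assms(3)])
  fix h x assume h: "h \<in> J" "x \<in> Y h"
  have A: "A x = scale (th (int h)) x" using h assms(1) by (intro up.A_Y) auto
  show "A x - scale (th (int l)) x \<in> up.sum_span Y (J - {l})"
  proof (cases "h = l")
    case True
    then show ?thesis by (simp add: A up.subspace_0)
  next
    case False
    then have "x \<in> up.sum_span Y (J - {l})" using h by (intro up.sum_span_base[of h]) auto
    then show ?thesis unfolding A by (intro up.subspace_diff up.subspace_scale) simp_all
  qed
qed simp

lemma shifts_kill:
  assumes "J \<subseteq> {..d}" "set js \<subseteq> {..d}" "v \<in> up.sum_span Y J"
  shows "A_shifts js v \<in> up.sum_span Y (J - set js)"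
  using assms(2)
proof (induction js)
  case (Cons j js)
  then have "A_shifts (j # js) v \<in> up.sum_span Y (J - set js - {j})"
    unfolding up.shifts_simps using assms(1) by (intro A_shift_sum_span) auto
  also have "J - set js - {j} = J - set (j # js)" by auto
  finally show ?case .
qed (use assms in simp)

lemma A_shift_surj:
  assumes "J \<subseteq> {..d}" "l \<le> d" "l \<notin> J" "v \<in> up.sum_span Y J"
  shows "\<exists>z\<in>up.sum_span Y J. A z - scale (th (int l)) z = v"
proof -
  let ?f = "\<lambda>z. A z - scale (th (int l)) z"
  have "v \<in> ?f ` up.sum_span Y J"
  proof (rule up.endo_sum_span_into[of "\<lambda>v. v" "?f ` up.sum_span Y J" J Y v])
    show "up.endo (\<lambda>v. v)" by (rule up.endoI) auto
    have f: "up.endo ?f" by (rule up.endo_shift[OF up.endo_A])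
    show "up.subspace (?f ` up.sum_span Y J)"
      by (rule module_hom.subspace_image[OF f[unfolded linear_iff_module_hom] up.subspace_sum_span])
    fix h x assume h: "h \<in> J" "x \<in> Y h"
    define c where "c = th (int h) - th (int l)"
    have c: "c \<noteq> 0" using th_inj[of h l] h assms by (auto simp: c_def)
    have "A x = scale (th (int h)) x" using h assms(1) by (intro up.A_Y) auto
    then have "?f x = scale c x" by (simp add: c_def up.scale_left_diff_distrib)
    then have "x = ?f (scale (inverse c) x)"
      unfolding up.endo_scale[OF f] using c by simp
    moreover have "scale (inverse c) x \<in> up.sum_span Y J"
      using h by (intro up.subspace_scale up.sum_span_base[of h]) simp_all
    ultimately show "x \<in> ?f ` up.sum_span Y J" by (rule image_eqI)
  qed (rule assms(4))
  then show ?thesis by blast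
qed

lemma shifts_surj:
  assumes "J \<subseteq> {..d}" "set js \<subseteq> {..d} - J" "v \<in> up.sum_span Y J"
  shows "\<exists>z\<in>up.sum_span Y J. A_shifts js z = v"
  using assms(2,3)
proof (induction js arbitrary: v)
  case (Cons j js)
  have "j \<le> d" "j \<notin> J" using Cons.prems(1) by auto
  then obtain z where z: "z \<in> up.sum_span Y J" "A z - scale (th (int j)) z = v"
    using A_shift_surj[OF assms(1) _ _ Cons.prems(2)] by blast
  have "\<exists>z'\<in>up.sum_span Y J. A_shifts js z' = z"
    using Cons.prems(1) z(1) by (intro Cons.IH) auto
  then obtain z' where "z' \<in> up.sum_span Y J" "A_shifts js z' = z" by blast
  then show ?case using z(2) by (intro bexI[of _ z']) simp_all
qed auto

text \<open>
  Take \<open>w\<close> in \<open>F \<inter> G\<close>. The product of the shifts by \<open>\<theta>\<^sub>l, \<dots>, \<theta>\<^sub>d\<^sub>-\<^sub>l\<^sub>-\<^sub>1\<close> is invertible on \<open>G\<close>; splitting a preimage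
  of \<open>w\<close> along \<open>V = F + H\<close>, the \<open>H\<close> part is sent into a subspace meeting \<open>F\<close> trivially.
\<close>
lemma lefschetz_surj:
  assumes "2 * l \<le> d" "w \<in> F (int d - int l)"
  shows "\<exists>f\<in>F (int l). w - (A ^^ (d - 2 * l)) f \<in> F (int d - int l - 1)"
proof -
  obtain u g where ug: "u \<in> F (int d - int l)" "u \<in> up.G (int d - int l)"
      "g \<in> F (int d - int l - 1)" "w = u + g"
    using assms(2) by (rule up.F_decomp)
  let ?J = "{h. h \<le> d \<and> int d - int l \<le> int h}" and ?js = "[l..<d - l]"
  have "\<exists>z\<in>up.sum_span Y ?J. A_shifts ?js z = u"
    using ug(2) by (intro shifts_surj) (auto simp: up.G_def)
  then obtain z where z: "A_shifts ?js z = u" by blast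
  obtain x y where xy: "x \<in> F (int l)" "y \<in> down.G (int l + 1)" "z = x + y"
    using down.F_plus_G[of "int l + 1" z] by auto
  have len: "length ?js = d - 2 * l" by simp
  have shx: "A_shifts ?js x - (A ^^ (d - 2 * l)) x \<in> F (int d - int l - 1)"
    using shifts_F[OF xy(1), of ?js] assms(1) unfolding len by (simp add: of_nat_diff algebra_simps)
  have "(A ^^ (d - 2 * l)) x \<in> F (int d - int l)"
    using A_pow_F[OF xy(1), of "d - 2 * l"] assms(1) by (simp add: of_nat_diff algebra_simps)
  then have "(A_shifts ?js x - (A ^^ (d - 2 * l)) x) + (A ^^ (d - 2 * l)) x \<in> F (int d - int l)"
    using up.F_mono[OF shx, of "int d - int l"] by (intro up.subspace_add) simp_all
  then have "u - A_shifts ?js x \<in> F (int d - int l)"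
    using ug(1) by (intro up.subspace_diff) simp_all
  moreover have "u - A_shifts ?js x = A_shifts ?js y"
    using z by (simp add: xy up.endo_add[OF up.endo_shifts[OF up.endo_A]] algebra_simps)
  \<comment> \<open>\<open>y\<close> has components \<open>0, ..., d - l - 1\<close>, and the
    product removes \<open>l, ..., d - l - 1\<close>. Those below \<open>l\<close> remain, and their
    span is opposite to \<open>F (d - l)\<close>.\<close>
  moreover have "A_shifts ?js y \<in> up.sum_span Y ({h. h \<le> d \<and> int h \<le> int d - (int l + 1)} - set ?js)"
    using xy(2) unfolding down_G_eq by (intro shifts_kill) auto
  moreover have "\<dots> \<subseteq> down.G (int d - int l + 1)"
    unfolding down_G_eq by (intro up.sum_span_mono) auto
  ultimately have "u - A_shifts ?js x = 0"
    using down.F_Int_G[of "u - A_shifts ?js x" "int d - int l" "int d - int l + 1"] by auto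
  then have "w - (A ^^ (d - 2 * l)) x = (A_shifts ?js x - (A ^^ (d - 2 * l)) x) + g"
    by (simp add: ug algebra_simps)
  also have "\<dots> \<in> F (int d - int l - 1)" using shx ug(3) by (intro up.subspace_add) simp_all
  finally show ?thesis using xy(1) by blast
qed

text \<open>An argument as for sl_2. If \<open>C\<close> lowers the flag by \<open>m \<ge> 1\<close>
  steps, then on quotients it commutes with \<open>A\<close> up to \<open>s\<close>, and this forces
  it to lower by \<open>m + 1\<close>: \<open>low\<close> treats the lower half of the flag, and
  \<open>high\<close> carries the result to the upper half.\<close>

lemma filtered_zero:
  assumes C: "up.endo C" and s: "s \<noteq> 0"
    and lower: "\<And>i v. v \<in> F i \<Longrightarrow> C v \<in> F (i - 1)"
    and comm: "\<And>m i v. (\<And>j w. w \<in> F j \<Longrightarrow> C w \<in> F (j - m)) \<Longrightarrow> v \<in> F i \<Longrightarrow>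
      C (A v) - scale s (A (C v)) \<in> F (i - m)"
  shows "C v = 0"
proof -
  have step_down: "\<forall>i. \<forall>v\<in>F i. C v \<in> F (i - (m + 1))"
    if m: "1 \<le> m" and IH: "\<And>j w. w \<in> F j \<Longrightarrow> C w \<in> F (j - m)" for m
  proof -
    have pow: "C ((A ^^ k) u) - scale (s ^ k) ((A ^^ k) (C u)) \<in> F (i + int k - 1 - m)"
      if "u \<in> F i" for u i k
    proof (induction k)
      case 0
      then show ?case by (simp add: up.subspace_0)
    next
      case (Suc k)
      have 1: "C (A ((A ^^ k) u)) - scale s (A (C ((A ^^ k) u))) \<in> F (i + int k - m)"
        by (rule comm[OF IH A_pow_F[OF that]])
      have 2: "A (C ((A ^^ k) u) - scale (s ^ k) ((A ^^ k) (C u))) \<in> F (i + int k - m)"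
        using up.A_F[OF Suc] by (simp add: algebra_simps)
      have "(C (A ((A ^^ k) u)) - scale s (A (C ((A ^^ k) u))))
          + scale s (A (C ((A ^^ k) u) - scale (s ^ k) ((A ^^ k) (C u)))) \<in> F (i + int k - m)"
        using 1 2 by (intro up.subspace_add up.subspace_scale) simp_all
      then show ?case by (simp add: up.endo_simps[OF up.endo_A] up.scale_right_diff_distrib)
    qed
    \<comment> \<open>Induction by primitive decomposition: up to lower terms, a vector of layer
      \<open>l + 1\<close> is \<open>A f\<close> with \<open>f\<close> in layer \<open>l\<close>
      plus a vector whose image under \<open>A ^^ k\<close> drops below its expected degree.\<close>
    have low: "C u \<in> F (int l - m - 1)" if "2 * l \<le> d" "u \<in> F (int l)" for l u
      using that
    proof (induction l arbitrary: u)
      case (0 u)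
      define k where "k = d + 1"
      have k: "int k = int d + 1" by (simp add: k_def)
      have u: "u \<in> F 0" using 0 by simp
      have "C ((A ^^ k) u) \<in> F (int d - m)"
        by (rule IH) (simp add: up.F_top)
      then have "(A ^^ k) (C u) \<in> F (int d - m)"
        using pow[OF u, of k] s
        by - (rule up.subspace_cancel[of _ "s ^ k" "C ((A ^^ k) u)"], simp_all add: k)
      then show ?case
        using lefschetz_inj[of "C u" "- m" k] IH[OF u] m by (simp add: k)
    next
      case (Suc l u)
      define k where "k = d - 2 * Suc l + 1"
      have k: "int k = int d - 2 * int l - 1" using Suc.prems(1) unfolding k_def by arith
      have k': "d - 2 * l = Suc k" using Suc.prems(1) unfolding k_def by arith
      have "(A ^^ k) u \<in> F (int d - int l)"
        using A_pow_F[OF Suc.prems(2), of k] by (simp add: k)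
      then obtain f where f: "f \<in> F (int l)" "(A ^^ k) u - (A ^^ Suc k) f \<in> F (int d - int l - 1)"
        using lefschetz_surj[of l "(A ^^ k) u"] Suc.prems(1) unfolding k' by force
      \<comment> \<open>\<open>A f\<close> and \<open>u\<close> have the same image under
        \<open>A ^^ k\<close> modulo lower degree, which makes \<open>y\<close> primitive.\<close>
      define y where "y = u - A f"
      have y: "y \<in> F (int (Suc l))"
        using Suc.prems(2) up.A_F[OF f(1)] by (auto simp: y_def add.commute intro!: up.subspace_diff)
      have "(A ^^ k) y \<in> F (int d - int l - 1)"
        using f(2) by (simp add: y_def up.endo_simps[OF up.endo_funpow[OF up.endo_A]] funpow_swap1)
      then have "C ((A ^^ k) y) \<in> F (int d - int l - 1 - m)" by (rule IH)
      moreover have "int (Suc l) + int k - 1 - m = int d - int l - 1 - m" by (simp add: k)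
      then have "C ((A ^^ k) y) - scale (s ^ k) ((A ^^ k) (C y)) \<in> F (int d - int l - 1 - m)"
        using pow[OF y, of k] by (simp only:)
      ultimately have "(A ^^ k) (C y) \<in> F (int d - int l - 1 - m)"
        using up.subspace_cancel[OF up.subspace_F, of "s ^ k"] s by (metis power_not_zero)
      moreover have "int d - int l - 1 - m = (int (Suc l) - m) + int k - 1" by (simp add: k)
      ultimately have "(A ^^ k) (C y) \<in> F ((int (Suc l) - m) + int k - 1)" by (simp only:)
      \<comment> \<open>\<open>C y\<close> has degree \<open>l + 1 - m\<close>, where
        \<open>A ^^ k\<close> is still injective:
        \<open>2 * (l + 1 - m) + k = d + 1 - 2 * m\<close>, and \<open>m \<ge> 1\<close>.\<close>
      then have 1: "C y \<in> F (int (Suc l) - m - 1)"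
        using lefschetz_inj[OF IH[OF y], of k] m k by simp
      have "C f \<in> F (int l - m - 1)" using Suc.IH Suc.prems(1) f(1) by simp
      then have "(C (A f) - scale s (A (C f))) + scale s (A (C f)) \<in> F (int l - m)"
        using comm[OF IH f(1)] up.A_F[of "C f" "int l - m - 1"]
        by (intro up.subspace_add up.subspace_scale) simp_all
      then have "C (A f) \<in> F (int (Suc l) - m - 1)" by simp
      then have "C y + C (A f) \<in> F (int (Suc l) - m - 1)" using 1 by (intro up.subspace_add) simp_all
      then show ?case by (simp add: y_def up.endo_diff[OF C])
    qed
    \<comment> \<open>Each class of the upper half is \<open>A ^^ k\<close> of a class of the lower
      half, to which \<open>low\<close> applies.\<close>
    have high: "C u \<in> F (int d - int l - m - 1)" if lu: "2 * l \<le> d" "u \<in> F (int d - int l)" for l u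
    proof -
      define k where "k = d - 2 * l"
      have k: "int k = int d - 2 * int l" using lu(1) by (simp add: k_def)
      obtain f where f: "f \<in> F (int l)" "u - (A ^^ k) f \<in> F (int d - int l - 1)"
        using lefschetz_surj[OF lu] unfolding k_def by blast
      have 1: "C (u - (A ^^ k) f) \<in> F (int d - int l - m - 1)"
        using IH[OF f(2)] by (simp add: algebra_simps)
      have "(A ^^ k) (C f) \<in> F (int d - int l - m - 1)"
        using A_pow_F[OF low[OF lu(1) f(1)], of k] by (simp add: k algebra_simps)
      then have "(C ((A ^^ k) f) - scale (s ^ k) ((A ^^ k) (C f))) + scale (s ^ k) ((A ^^ k) (C f))
          \<in> F (int d - int l - m - 1)"
        using pow[OF f(1), of k] by (intro up.subspace_add up.subspace_scale) (simp_all add: k algebra_simps)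
      then have "C (u - (A ^^ k) f) + C ((A ^^ k) f) \<in> F (int d - int l - m - 1)"
        using 1 by (intro up.subspace_add) simp_all
      then show ?thesis by (simp add: up.endo_diff[OF C])
    qed
    show ?thesis
    proof (intro allI ballI)
      fix i v assume v: "v \<in> F i"
      consider "i < 0" | "0 \<le> i" "2 * i \<le> int d" | "int d < 2 * i" "i \<le> int d" | "int d < i" by linarith
      then show "C v \<in> F (i - (m + 1))"
      proof cases
        case 1
        then show ?thesis using v by (simp add: up.F_neg up.endo_zero[OF C] up.subspace_0)
      next
        case 2
        then show ?thesis using low[of "nat i" v] v by (simp add: algebra_simps)
      next
        case 3
        then show ?thesis using high[of "nat (int d - i)" v] v by (simp add: algebra_simps)
      next
        case 4
        have "C v \<in> F (int d - m - 1)" using high[of 0 v] by (simp add: up.F_top)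
        then show ?thesis by (rule up.F_mono) (use 4 in simp)
      qed
    qed
  qed
  have "\<forall>i. \<forall>v\<in>F i. C v \<in> F (i - m)" if "1 \<le> m" for m
    using that
  proof (induction m rule: int_ge_induct)
    case base
    then show ?case using lower by blast
  next
    case (step m)
    then show ?case using step_down by blast
  qed
  \<comment> \<open>After \<open>d + 1\<close> steps the image of the whole space lies in
    \<open>F (-1)\<close>, which is zero.\<close>
  from this[of "int d + 1"] have "\<forall>v\<in>F (int d). C v \<in> F (int d - (int d + 1))"
    by (metis le_add_same_cancel2 of_nat_0_le_iff)
  then have "C v \<in> F (int d - (int d + 1))" by (simp add: up.F_top)
  then show ?thesis by (simp add: up.F_neg)
qed

end

section \<open>The quadratic relation between \<open>K\<close> and \<open>B\<close>\<close>

locale racah_splits = two_splits scale A As X Y th ths d E +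
  upq: q_split scale A As X Y th ths d q a a' K +
  downq: q_split scale A As X "\<lambda>h. Y (d - h)" "\<lambda>j. th (int d - j)" ths d q a' a B
  for scale :: "'k::field \<Rightarrow> 'v::ab_group_add \<Rightarrow> 'v" and A As X Y th ths d E q a a' K B +
  fixes t :: 'k
  assumes t_eq: "t = q\<^sup>2" and d_pos: "1 \<le> d" and a_neq: "a \<noteq> a'"
    and t_pow_neq: "\<And>k. 1 \<le> k \<Longrightarrow> k \<le> d \<Longrightarrow> t ^ k \<noteq> 1"
begin

abbreviation "ev \<equiv> upq.ev"

lemma t_nonzero: "t \<noteq> 0"
  by (simp add: t_eq upq.q_nonzero)

lemma ev_Suc: "t * ev (i + 1) = ev i"
  by (simp add: t_eq upq.ev_Suc)

lemmas hom = up.endo_simps[OF up.endo_A] up.endo_simps[OF upq.endo_K] up.endo_simps[OF downq.endo_K]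

lemma inverse_collapse: "a * a' = 1" "a * (a' * x) = x"
  using upq.a_inverse by (simp_all flip: mult.assoc)

text \<open>This is \<open>t D S - S D\<close> for the maps \<open>S\<close> and \<open>D\<close>
  below, expanded into monomials in \<open>K\<close> and \<open>B\<close>.\<close>

definition C :: "'v \<Rightarrow> 'v" where
  "C v = scale ((t - 1) * a) (K (K v)) + scale ((t - 1) * a') (B (B v))
    - scale (a' * t - a) (K (B v)) - scale (a * t - a') (B (K v))"

lemma endo_C: "up.endo C"
  by (rule up.endoI) (simp_all add: C_def hom algebra_simps)

abbreviation (input) "K_defect v \<equiv> scale (t - 1) (scale a (K (K v)) + scale a' v)"
abbreviation (input) "B_defect v \<equiv> scale (t - 1) (scale a' (B (B v)) + scale a v)"

lemma K_A: "scale t (K (A v)) = A (K v) + K_defect v"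
  and B_A: "scale t (B (A v)) = A (B v) + B_defect v"
  using upq.K_A downq.K_A by (auto simp: t_eq)

text \<open>\<open>A\<close> is moved to the left past \<open>g\<close> and then past
  \<open>f\<close>; each passage absorbs one factor \<open>t\<close> and leaves a defect.\<close>

lemma two_step:
  assumes "up.endo f" "\<And>v. scale t (f (A v)) = A (f v) + r v" "\<And>v. scale t (g (A v)) = A (g v) + s v"
  shows "scale (t * t) (f (g (A v))) = A (f (g v)) + r (g v) + scale t (f (s v))"
proof -
  have "scale (t * t) (f (g (A v))) = scale t (f (scale t (g (A v))))"
    by (simp add: up.endo_simps[OF assms(1)])
  also have "\<dots> = scale t (f (A (g v))) + scale t (f (s v))"
    unfolding assms(3) by (simp add: up.endo_simps[OF assms(1)] up.scale_right_distrib)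
  finally show ?thesis by (simp only: assms(2))
qed

lemmas KK_A = two_step[where f = K and g = K and r = "\<lambda>v. K_defect v" and s = "\<lambda>v. K_defect v", OF upq.endo_K K_A K_A]
  and KB_A = two_step[where f = K and g = B and r = "\<lambda>v. K_defect v" and s = "\<lambda>v. B_defect v", OF upq.endo_K K_A B_A]
  and BK_A = two_step[where f = B and g = K and r = "\<lambda>v. B_defect v" and s = "\<lambda>v. K_defect v", OF downq.endo_K B_A K_A]
  and BB_A = two_step[where f = B and g = B and r = "\<lambda>v. B_defect v" and s = "\<lambda>v. B_defect v", OF downq.endo_K B_A B_A]

lemma C_A: "scale (t * t) (C (A v)) - A (C v) = scale (t - 1)
  (scale ((t - 1) * a) (scale (t + 1) (scale a (K (K (K v))) + scale a' (K v)))
    + scale ((t - 1) * a') (scale (t + 1) (scale a' (B (B (B v))) + scale a (B v)))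
    - scale (a' * t - a) (scale a (K (K (B v))) + scale a' (B v) + scale t (scale a' (K (B (B v))) + scale a (K v)))
    - scale (a * t - a') (scale a' (B (B (K v))) + scale a (K v) + scale t (scale a (B (K (K v))) + scale a' (B v))))"
proof -
  have KK: "scale (t * t) (K (K (A v))) - A (K (K v))
    = scale (t - 1) (scale (t + 1) (scale a (K (K (K v))) + scale a' (K v)))"
    unfolding KK_A by (simp add: hom algebra_simps)
  have BB: "scale (t * t) (B (B (A v))) - A (B (B v))
    = scale (t - 1) (scale (t + 1) (scale a' (B (B (B v))) + scale a (B v)))"
    unfolding BB_A by (simp add: hom algebra_simps)
  have KB: "scale (t * t) (K (B (A v))) - A (K (B v)) = scale (t - 1)
      (scale a (K (K (B v))) + scale a' (B v) + scale t (scale a' (K (B (B v))) + scale a (K v)))"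
    unfolding KB_A by (simp add: hom algebra_simps)
  have BK: "scale (t * t) (B (K (A v))) - A (B (K v)) = scale (t - 1)
      (scale a' (B (B (K v))) + scale a (K v) + scale t (scale a (B (K (K v))) + scale a' (B v)))"
    unfolding BK_A by (simp add: hom algebra_simps)
  have *: "scale (t * t) (scale p x1 + scale p' x2 - scale e x3 - scale f x4)
      - (scale p y1 + scale p' y2 - scale e y3 - scale f y4)
    = scale p (scale (t * t) x1 - y1) + scale p' (scale (t * t) x2 - y2)
      - scale e (scale (t * t) x3 - y3) - scale f (scale (t * t) x4 - y4)"
    for p p' e f x1 x2 x3 x4 y1 y2 y3 y4
    by (simp add: algebra_simps)
  have **: "scale p (scale r x1) + scale p' (scale r x2) - scale e (scale r x3) - scale f (scale r x4)
    = scale r (scale p x1 + scale p' x2 - scale e x3 - scale f x4)" for p p' e f r x1 x2 x3 x4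
    by (simp add: algebra_simps)
  show ?thesis
    unfolding C_def[of "A v"] C_def[of v] hom * KK BB KB BK ** ..
qed

text \<open>Normal form of the bracket in \<open>C_A\<close>, with \<open>kkb\<close> for
  \<open>K (K (B v))\<close> and so on. \<open>C_coefficients\<close> does the same for a
  combination of \<open>K C\<close>, \<open>C K\<close>, \<open>B C\<close> and \<open>C B\<close>,
  so that the two can be compared.\<close>

lemma defect_coefficients:
  "scale (p * a) (scale r (scale a kkk + scale a' k)) + scale (p * a') (scale r (scale a' bbb + scale a b))
    - scale e (scale a kkb + scale a' b + scale t (scale a' kbb + scale a k))
    - scale f (scale a' bbk + scale a k + scale t (scale a bkk + scale a' b))
  = scale (p * a * r * a) kkk + scale (p * a' * r * a') bbb - scale (e * a) kkb - scale (e * t * a') kbb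
    - scale (f * a') bbk - scale (f * t * a) bkk
    + scale (p * a * r * a' - e * t * a - f * a) k + scale (p * a' * r * a - e * a' - f * t * a') b"
  by (simp add: algebra_simps)

lemma C_coefficients:
  "scale c1 (scale (p * a) kkk + scale (p * a') kbb - scale e kkb - scale f kbk)
    + scale c2 (scale (p * a) kkk + scale (p * a') bbk - scale e kbk - scale f bkk)
    + scale c3 (scale (p * a) bkk + scale (p * a') bbb - scale e bkb - scale f bbk)
    + scale c4 (scale (p * a) kkb + scale (p * a') bbb - scale e kbb - scale f bkb)
  = scale ((c1 + c2) * p * a) kkk + scale ((c3 + c4) * p * a') bbb - scale (c1 * e - c4 * p * a) kkb
    - scale (c4 * e - c1 * p * a') kbb - scale (c3 * f - c2 * p * a') bbk - scale (c2 * f - c3 * p * a) bkk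
    - scale (c1 * f + c2 * e) kbk - scale (c3 * e + c4 * f) bkb"
  by (simp add: algebra_simps)

text \<open>Every term on the right contains \<open>C\<close> once, and \<open>K\<close> and
  \<open>B\<close> preserve the flag; hence the right side lowers the flag as far as
  \<open>C\<close> does.\<close>

lemma C_commutator:
  "scale (a - a') (scale (t * t) (C (A v)) - A (C v)) = scale (t - 1)
    (scale (a * a - t) (K (C v)) + scale (t * (a * a) - 1) (C (K v))
      + scale (t - a' * a') (B (C v)) + scale (1 - a' * a' * t) (C (B v)))"
proof -
  let ?p = "t - 1" and ?r = "t + 1" and ?e = "a' * t - a" and ?f = "a * t - a'"
  let ?c1 = "a * a - t" and ?c2 = "t * (a * a) - 1" and ?c3 = "t - a' * a'" and ?c4 = "1 - a' * a' * t"
  \<comment> \<open>Six equations match the cubic monomials common to both normal forms, two remove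
    \<open>K B K\<close> and \<open>B K B\<close>, and the last two remove the terms linear in
    \<open>K\<close> and \<open>B\<close>.\<close>
  have coeff: "(?c1 + ?c2) * ?p * a = (a - a') * (?p * a * ?r * a)"
    "(?c3 + ?c4) * ?p * a' = (a - a') * (?p * a' * ?r * a')"
    "?c1 * ?e - ?c4 * ?p * a = (a - a') * (?e * a)"
    "?c4 * ?e - ?c1 * ?p * a' = (a - a') * (?e * t * a')"
    "?c3 * ?f - ?c2 * ?p * a' = (a - a') * (?f * a')"
    "?c2 * ?f - ?c3 * ?p * a = (a - a') * (?f * t * a)"
    "?c1 * ?f + ?c2 * ?e = 0" "?c3 * ?e + ?c4 * ?f = 0"
    "?p * a * ?r * a' - ?e * t * a - ?f * a = 0"
    "?p * a' * ?r * a - ?e * a' - ?f * t * a' = 0"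
    using upq.a_inverse by algebra+
  have mult: "scale (a - a') (scale ?p x) = scale ?p (scale (a - a') x)" for x
    by (rule up.scale_left_commute)
  show ?thesis
    unfolding C_A defect_coefficients mult unfolding C_def hom C_coefficients coeff
    by (simp only: up.scale_right_distrib up.scale_right_diff_distrib up.scale_scale up.scale_zero_left
        diff_zero add_0_right)
qed

lemma K_in: "v \<in> F i \<Longrightarrow> K v \<in> F i" and B_in: "v \<in> F i \<Longrightarrow> B v \<in> F i"
  using upq.K_F downq.K_F by blast+

lemma K_shift: "v \<in> F i \<Longrightarrow> K v - scale (ev i) v \<in> F (i - 1)"
  and B_shift: "v \<in> F i \<Longrightarrow> B v - scale (ev i) v \<in> F (i - 1)"
  using upq.K_F_shift downq.K_F_shift unfolding downq.ev_def upq.ev_def by blast+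

text \<open>On the quotient at \<open>i\<close> both \<open>K\<close> and \<open>B\<close> are the
  scalar \<open>ev i\<close>, and the four coefficients of \<open>C\<close> add up to zero.\<close>

lemma C_lower: 
  assumes "v \<in> F i" shows "C v \<in> F (i - 1)"
proof -
  let ?e = "ev i"
  define k where "k = K v - scale ?e v"
  define b where "b = B v - scale ?e v"
  have k: "k \<in> F (i - 1)" "K v = scale ?e v + k" and b: "b \<in> F (i - 1)" "B v = scale ?e v + b"
    using K_shift[OF assms] B_shift[OF assms] by (simp_all add: k_def b_def)
  have "C v = scale ((t - 1) * a) (K k + scale ?e k) + scale ((t - 1) * a') (B b + scale ?e b)
      - scale (a' * t - a) (K b + scale ?e k) - scale (a * t - a') (B k + scale ?e b)"
    unfolding C_def by (simp add: hom k(2) b(2) algebra_simps)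
  also have "\<dots> \<in> F (i - 1)"
    using k(1) b(1) K_in[OF k(1)] K_in[OF b(1)] B_in[OF k(1)] B_in[OF b(1)]
    by (intro up.subspace_add up.subspace_diff[OF up.subspace_F] up.subspace_scale) simp_all
  finally show ?thesis .
qed

lemma C_zero: "C v = 0"
proof (rule filtered_zero[OF endo_C, of "inverse (t * t)"])
  fix m i v assume m: "\<And>j w. w \<in> F j \<Longrightarrow> C w \<in> F (j - m)" and v: "v \<in> F i"
  \<comment> \<open>Multiplying by this nonzero factor turns the required commutation into
    \<open>C_commutator\<close>.\<close>
  let ?g = "(a - a') * (t * t)"
  have g: "?g \<noteq> 0" using t_nonzero a_neq by simp
  have g': "?g * inverse (t * t) = a - a'" using t_nonzero by (simp add: field_simps)
  have "scale ?g (C (A v) - scale (inverse (t * t)) (A (C v)))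
    = scale (a - a') (scale (t * t) (C (A v)) - A (C v))"
    by (simp only: up.scale_right_diff_distrib up.scale_scale g')
  also have "\<dots> \<in> F (i - m)"
    unfolding C_commutator using K_in[OF m[OF v]] B_in[OF m[OF v]] m[OF K_in[OF v]] m[OF B_in[OF v]]
    by (intro up.subspace_add up.subspace_scale) simp_all
  finally show "C (A v) - scale (inverse (t * t)) (A (C v)) \<in> F (i - m)"
    using up.subspace_scale_cancel[OF _ g] by simp
qed (use t_nonzero C_lower in auto)

section \<open>The eigenspaces of \<open>\<M>\<close>\<close>

definition S :: "'v \<Rightarrow> 'v" where "S v = scale a (K v) - scale a' (B v)"

definition D :: "'v \<Rightarrow> 'v" where "D v = K v - B v"

definition P :: "'v \<Rightarrow> 'v" where
  "P v = scale (a - a') (A v) - scale (a * a) (K v) + scale (a' * a') (B v)"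

lemma endo_S: "up.endo S" and endo_D: "up.endo D" and endo_P: "up.endo P"
  by (rule up.endoI; simp add: S_def D_def P_def hom algebra_simps)+

lemma S_D: "S (D v) = scale t (D (S v))"
proof -
  have "S (D v) - scale t (D (S v)) = - C v"
    by (simp add: S_def D_def C_def hom algebra_simps)
  then show ?thesis by (simp add: C_zero)
qed

lemma S_P: "scale t (S (P v)) = P (S v)"
proof -
  \<comment> \<open>The terms with \<open>A\<close> are grouped so that \<open>K_A\<close> and
    \<open>B_A\<close> apply. After that the constants cancel, and the quadratic terms add up to
    \<open>- C v\<close>.\<close>
  have "scale t (S (P v)) - P (S v)
    = scale (a * (a - a')) (scale t (K (A v)) - A (K v)) - scale (a' * (a - a')) (scale t (B (A v)) - A (B v))
      + (scale t (S (scale (a' * a') (B v) - scale (a * a) (K v)))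
        - scale (a' * a') (B (S v)) + scale (a * a) (K (S v)))"
    by (simp add: S_def P_def hom algebra_simps)
  also have "\<dots> = - C v"
    unfolding K_A B_A by (simp add: S_def C_def hom algebra_simps inverse_collapse)
  finally show ?thesis by (simp add: C_zero)
qed

lemma A_P_D: "scale (a - a') (A v) - scale (a + a') (S v) = P v - D v"
  by (simp add: S_def D_def P_def algebra_simps inverse_collapse)

section \<open>The scalars of \<open>S\<close> on the quotients of the flag, and the two ends of the
  progression\<close>

definition c :: "nat \<Rightarrow> 'k" where "c j = (a - a') * ev (int j)"

lemma ev_add: "t ^ k * ev (i + int k) = ev i"
proof (induction k)
  case (Suc k)
  have "t ^ Suc k * ev (i + int (Suc k)) = t ^ k * (t * ev (i + int k + 1))"
    by (simp add: mult_ac add_ac)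
  then show ?case using Suc by (simp only: ev_Suc)
qed simp

lemma ev_neq:
  assumes "i < j" "j \<le> i + int d" shows "ev i \<noteq> ev j"
proof
  assume eq: "ev i = ev j"
  have "t ^ nat (j - i) * ev j = ev i" using ev_add[of "nat (j - i)" i] assms by simp
  then have "t ^ nat (j - i) = 1" using eq upq.ev_nonzero[of j] by simp
  then show False using t_pow_neq[of "nat (j - i)"] assms by simp
qed

lemma S_shift: "v \<in> F i \<Longrightarrow> S v - scale ((a - a') * ev i) v \<in> F (i - 1)"
proof -
  assume v: "v \<in> F i"
  have "S v - scale ((a - a') * ev i) v = scale a (K v - scale (ev i) v) - scale a' (B v - scale (ev i) v)"
    by (simp add: S_def algebra_simps)
  also have "\<dots> \<in> F (i - 1)"
    using up.subspace_diff[OF up.subspace_F up.subspace_scale[OF up.subspace_F K_shift[OF v]]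
        up.subspace_scale[OF up.subspace_F B_shift[OF v]]] .
  finally show ?thesis .
qed

text \<open>The last factor of the list acts first, and \<open>S - c j\<close> takes
  \<open>F j\<close> into \<open>F (j - 1)\<close>.\<close>

lemma shifts_S_F: "v \<in> F (int n) \<Longrightarrow> up.shifts S c [0..<Suc n] v = 0"
proof (induction n arbitrary: v)
  case 0
  then show ?case using S_shift[of v 0] by (simp add: c_def up.F_neg)
next
  case (Suc n)
  have "S v - scale (c (Suc n)) v \<in> F (int n)"
    using S_shift[OF Suc.prems] by (simp add: c_def)
  then have "up.shifts S c [0..<Suc n] (S v - scale (c (Suc n)) v) = 0" by (rule Suc.IH)
  moreover have "up.shifts S c [0..<Suc (Suc n)] v = up.shifts S c [0..<Suc n] (up.shifts S c [Suc n] v)"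
    by (simp add: up.shifts_append)
  ultimately show ?case by simp
qed

text \<open>Both \<open>S P\<close> compared with \<open>P S\<close> and \<open>c (Suc j)\<close>
  compared with \<open>c j\<close> carry the factor \<open>inverse t\<close>, so each factor passes
  \<open>P\<close> with its index lowered by one.\<close>

lemma shifts_S_P:
  "up.shifts S c (map Suc js) (P v) = scale (inverse t ^ length js) (P (up.shifts S c js v))"
proof (induction js)
  case (Cons j js)
  let ?w = "up.shifts S c js v"
  have S_P': "S (P w) = scale (inverse t) (P (S w))" for w
    using t_nonzero by (simp flip: S_P)
  have c_Suc: "c (Suc j) = inverse t * c j"
    using t_nonzero ev_Suc[of "int j"] by (simp add: c_def field_simps)
  have "S (P ?w) - scale (c (Suc j)) (P ?w) = scale (inverse t) (P (S ?w - scale (c j) ?w))"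
    by (simp add: S_P' c_Suc up.endo_simps[OF endo_P] up.scale_right_diff_distrib)
  moreover have "up.shifts S c (map Suc (j # js)) (P v)
    = scale (inverse t ^ length js) (S (P ?w) - scale (c (Suc j)) (P ?w))"
    using Cons by (simp add: up.endo_simps[OF endo_S] up.scale_right_diff_distrib mult.commute)
  ultimately show ?case by (simp add: mult.commute)
qed simp

text \<open>\<open>A\<close> and \<open>K\<close> are scalars on the last split summand, so
  \<open>P u\<close> and \<open>S u\<close> are combinations of \<open>u\<close> and
  \<open>B u\<close>; \<open>ev 0 * ev d = 1\<close> matches the coefficients.\<close>

lemma P_top:
  assumes "u \<in> up.G (int d)" "u \<in> F (int d)"
  shows "P u = scale (- a') (S u - scale (c 0) u)"
proof -
  have K: "K u = scale (ev (int d)) u" using upq.K_U[of "int d" u] assms by (simp add: upq.ev_def)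
  have A: "A u = scale (th (int d)) u" using assms(1) by (rule upq.A_top)
  have e: "ev 0 * ev (int d) = 1"
    using upq.q_nonzero by (simp add: upq.ev_def power_int_minus)
  then have inv: "inverse (ev (int d)) = ev 0" by (metis inverse_unique mult.commute)
  have th: "th (int d) = a * ev (int d) + a' * ev 0"
    using upq.th_eq[of "int d"] inv by (simp add: upq.ev_def)
  have "(a - a') * (a * x + a' * y) - a * a * x = - a' * (a * x - (a - a') * y)" for x y
    by (simp add: algebra_simps)
  then have "(a - a') * th (int d) - a * a * ev (int d) = - a' * (a * ev (int d) - (a - a') * ev 0)"
    unfolding th .
  then have "scale ((a - a') * th (int d) - a * a * ev (int d)) u
      = scale (- a' * (a * ev (int d) - (a - a') * ev 0)) u" by simp
  then show ?thesis
    unfolding P_def S_def K A c_def by (simp add: algebra_simps)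
qed

text \<open>
  The product of all \<open>S - c j\<close> with \<open>1 \<le> j \<le> d\<close> annihilates the image of \<open>P\<close>. It does not annihilate an
  eigenvector of \<open>S\<close> for the eigenvalue continuing the progression beyond \<open>d\<close>, even if that eigenvalue is \<open>c 0\<close>.
\<close>
lemma shifts_S_P_zero: "up.shifts S c [1..<Suc d] (P v) = 0"
proof -
  obtain n where n: "d = Suc n" using d_pos by (cases d) auto
  have js: "[1..<Suc d] = map Suc [0..<d]" by (simp add: map_Suc_upt)
  have js': "[0..<Suc d] = 0 # [1..<Suc d]" by (simp add: upt_conv_Cons)
  \<comment> \<open>On \<open>f\<close> the product passes \<open>P\<close> and becomes one that
    kills \<open>F (d - 1)\<close>. On \<open>u\<close>, \<open>P\<close> itself is the missing
    factor \<open>S - c 0\<close> up to a scalar, and the completed product kills the whole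
    space.\<close>
  obtain u f where uf: "u \<in> F (int d)" "u \<in> up.G (int d)" "f \<in> F (int d - 1)" "v = u + f"
    using up.F_decomp[of v "int d"] by (auto simp: up.F_top)
  have "up.shifts S c [0..<d] f = 0" using shifts_S_F[of f n] uf(3) by (simp add: n)
  then have f: "up.shifts S c [1..<Suc d] (P f) = 0"
    unfolding js shifts_S_P by (simp add: up.endo_zero[OF endo_P])
  have "up.shifts S c [1..<Suc d] (S u - scale (c 0) u) = up.shifts S c [0..<Suc d] u"
    unfolding js' up.shifts_simps by (rule up.shifts_commute[OF endo_S])
  also have "\<dots> = 0" using uf(1) by (rule shifts_S_F)
  finally have "up.shifts S c [1..<Suc d] (P u) = 0"
    unfolding P_top[OF uf(2,1)] up.endo_scale[OF up.endo_shifts[OF endo_S]] by simp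
  then show ?thesis
    using f by (simp only: uf(4) up.endo_add[OF endo_P] up.endo_add[OF up.endo_shifts[OF endo_S]] add_0_left)
qed

lemma P_eigenvector:
  assumes "S v = scale ((a - a') * ev i) v"
  shows "S (P v) = scale ((a - a') * ev (i + 1)) (P v)"
proof -
  have "scale t (S (P v)) = scale t (scale ((a - a') * ev (i + 1)) (P v))"
    using ev_Suc[of i] by (simp add: S_P assms up.endo_simps[OF endo_P] mult.left_commute)
  then show ?thesis by (rule up.scale_left_imp_eq[OF t_nonzero])
qed

lemma D_eigenvector:
  assumes "S v = scale ((a - a') * ev i) v"
  shows "S (D v) = scale ((a - a') * ev (i - 1)) (D v)"
  using ev_Suc[of "i - 1"] by (simp add: S_D assms up.endo_simps[OF endo_D] mult.left_commute)

lemma P_eigenvector_top: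
  assumes "S v = scale ((a - a') * ev (int d)) v"
  shows "P v = 0"
proof -
  let ?m = "(a - a') * ev (int d + 1)"
  have zero: "scale (\<Prod>j\<leftarrow>[1..<Suc d]. ?m - c j) (P v) = 0"
    using up.shifts_eigenvector[OF endo_S P_eigenvector[OF assms], of c "[1..<Suc d]", symmetric]
    unfolding shifts_S_P_zero .
  \<comment> \<open>As \<open>j\<close> starts at 1, the difference \<open>d + 1 - j\<close> lies
    between 1 and \<open>d\<close>, within the range of \<open>ev_neq\<close>.\<close>
  have ne: "?m - c j \<noteq> 0" if "j \<in> set [1..<Suc d]" for j
    using ev_neq[of "int j" "int d + 1"] that a_neq by (auto simp: c_def)
  have "0 \<notin> (\<lambda>j. ?m - c j) ` set [1..<Suc d]"
  proof
    assume "0 \<in> (\<lambda>j. ?m - c j) ` set [1..<Suc d]"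
    then obtain j where "j \<in> set [1..<Suc d]" and eq: "0 = ?m - c j" by (rule imageE)
    then have "?m - c j \<noteq> 0" by (intro ne)
    then show False unfolding eq [symmetric] by simp
  qed
  then have "(\<Prod>j\<leftarrow>[1..<Suc d]. ?m - c j) \<noteq> 0"
    by (simp only: prod_list_zero_iff set_map not_False_eq_True)
  with zero show ?thesis unfolding up.scale_eq_0_iff by blast
qed

text \<open>For \<open>i > 0\<close> the scalar of \<open>S\<close> on the quotient at
  \<open>i\<close> differs from the eigenvalue of \<open>v\<close>, so \<open>v\<close> descends
  through the flag to \<open>F 0\<close>, where \<open>K\<close> and \<open>B\<close> agree.\<close>

lemma D_eigenvector_bot:
  assumes "S v = scale ((a - a') * ev 0) v"
  shows "D v = 0"
proof -
  have "v \<in> F (int d - int k)" if "k \<le> d" for k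
    using that
  proof (induction k)
    case (Suc k)
    let ?i = "int d - int k"
    have "S v - scale ((a - a') * ev ?i) v \<in> F (?i - 1)" using Suc by (intro S_shift) simp
    then have "scale ((a - a') * (ev 0 - ev ?i)) v \<in> F (?i - 1)"
      by (simp add: assms algebra_simps)
    moreover have "(a - a') * (ev 0 - ev ?i) \<noteq> 0"
      using ev_neq[of 0 ?i] Suc.prems a_neq by simp
    ultimately have "v \<in> F (?i - 1)" using up.subspace_scale_cancel[OF up.subspace_F] by blast
    then show ?case by (simp add: algebra_simps)
  qed (simp add: up.F_top)
  from this[of d] have "v \<in> F 0" by simp
  then have "K v = scale (ev 0) v" "B v = scale (ev 0) v"
    using K_shift[of v 0] B_shift[of v 0] by (simp_all add: up.F_neg)
  then show ?thesis by (simp add: D_def)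
qed

end

section \<open>Passage between spans and the setwise sums and padded families of the
  definitions\<close>

context endo_space
begin

lemma sum_span_subset_set_sum:
  assumes "finite J" "\<And>h. h \<in> J \<Longrightarrow> subspace (X h)"
  shows "sum_span X J \<subseteq> (\<Sum>h\<in>J. X h)"
  using assms
proof (induction J rule: finite_induct)
  case empty
  then show ?case by (simp add: sum_span_def)
next
  case (insert j J)
  show ?case
  proof
    fix v assume "v \<in> sum_span X (insert j J)"
    then obtain x y where "x \<in> sum_span X {j}" "y \<in> sum_span X J" "v = x + y"
      using sum_span_Un[of v X "{j}" J] by auto
    moreover from this have "x \<in> X j"
      using span_eq_iff[THEN iffD2, OF insert.prems[of j]] by (simp add: sum_span_def)
    ultimately show "v \<in> (\<Sum>h\<in>insert j J. X h)"
      using insert by (auto simp: set_plus_intro)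
  qed
qed

lemma padded_subset_sum_span:
  assumes "{l. l \<le> d \<and> int l = i} \<subseteq> J"
  shows "padded d X i \<subseteq> sum_span X J"
proof (cases "0 \<le> i \<and> i \<le> int d")
  case True
  then have "nat i \<in> J" using assms by auto
  then show ?thesis using True sum_span_base[of "nat i" J _ X] by (auto simp: padded_def)
next
  case False
  then show ?thesis using subspace_0[OF subspace_sum_span] by (auto simp: padded_def)
qed

lemma tridiagonal_subset_sum_span:
  assumes "h \<le> d"
  shows "padded d X (int h - 1) + X h + padded d X (int h + 1)
    \<subseteq> sum_span X {l. l \<le> d \<and> int h - 1 \<le> int l \<and> int l \<le> int h + 1}" (is "_ \<subseteq> ?S")
proof
  fix v assume "v \<in> padded d X (int h - 1) + X h + padded d X (int h + 1)"
  then obtain x y z where "x \<in> padded d X (int h - 1)" "y \<in> X h" "z \<in> padded d X (int h + 1)" "v = x + y + z"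
    by (auto elim!: set_plus_elim)
  moreover have "padded d X (int h - 1) \<subseteq> ?S" "padded d X (int h + 1) \<subseteq> ?S"
    by (intro padded_subset_sum_span; auto)+
  ultimately show "v \<in> ?S"
    using sum_span_base[of h "{l. l \<le> d \<and> int h - 1 \<le> int l \<and> int l \<le> int h + 1}" y X] assms
    by (auto intro!: subspace_add)
qed

lemma idempotent_separates:
  assumes "endo f" "\<And>h x. h \<in> J \<Longrightarrow> x \<in> X h \<Longrightarrow> f x = 0" "f v \<noteq> 0"
  shows "sum_span X J \<noteq> UNIV"
proof
  assume "sum_span X J = UNIV"
  then have "f v \<in> {0}"
    using assms by (intro endo_sum_span_into[of f "{0}" J X v]) auto
  then show False using assms(3) by simp
qed

end

section \<open>From a TD system of \<open>q\<close>-Racah type to the flags, and the final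
  assembly\<close>

theorem lemma9p4:
  fixes scale :: "'k::alg_closed_field \<Rightarrow> 'v::ab_group_add \<Rightarrow> 'v"
    and Basis :: "'v set"
    and A As K B :: "'v \<Rightarrow> 'v"
    and E Es :: "nat \<Rightarrow> 'v \<Rightarrow> 'v"
    and d :: nat
    and q a b :: 'k
  assumes "finite_dimensional_vector_space scale Basis"
    and "(UNIV :: 'v set) \<noteq> {0}"
    and "TD_system scale d A E As Es"
    and "d \<ge> 1"
    and "q_Racah_type_with scale d A E As Es q a b"
    and "acts_on_split scale d q (split_decomp d E Es) K"
    and "acts_on_split scale d q (split_decomp_down d E Es) B"
  shows "\<forall>i\<le>d.
    (\<lambda>v. A v - scale ((a + inverse a) * q powi (int d - 2 * int i)) v)
        ` M_eigenspace scale d q a K B i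
      \<subseteq> padded d (M_eigenspace scale d q a K B) (int i - 1)
        + padded d (M_eigenspace scale d q a K B) (int i + 1)"
proof -
  interpret endo_space scale
    using assms(1) by (simp add: endo_space_def finite_dimensional_vector_space_def)
  define X where "X h = range (Es h)" for h
  define Y where "Y h = range (E h)" for h
  define a' where "a' = inverse a"
  define th where "th i = a * q powi (int d - 2 * i) + a' * inverse (q powi (int d - 2 * i))" for i
  define ths where "ths i = b * q powi (int d - 2 * i) + inverse b * inverse (q powi (int d - 2 * i))" for i
  note TD = assms(3)[unfolded TD_system_def]
  note pair = TD[THEN conjunct1, unfolded TD_pair_def]
  have A: "endo A" and As: "endo As" using pair by auto
  have E: "primitive_idempotent scale A (Y h) (E h)" and Es: "primitive_idempotent scale As (X h) (Es h)"
    if "h \<le> d" for h using TD that by (auto simp: X_def Y_def)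
  have ord: "standard_ordering scale A As d Y" and ords: "standard_ordering scale As A d X"
    using TD unfolding X_def Y_def by auto
  have bij: "bij_betw Y {..d} (eigenspaces scale A)" and bijs: "bij_betw X {..d} (eigenspaces scale As)"
    using ord ords by (auto simp: standard_ordering_def)
  have endo_E: "endo (E h)" if "h \<le> d" for h using E[OF that] by (simp add: primitive_idempotent_def)
  have E_same: "E h v = v" if "h \<le> d" "v \<in> Y h" for h v
    using E[OF that(1)] that(2) by (simp add: primitive_idempotent_def)
  have E_other: "E l v = 0" if "h \<le> d" "l \<le> d" "h \<noteq> l" "v \<in> Y h" for h l v
  proof -
    have "Y h \<in> eigenspaces scale A" "Y h \<noteq> Y l"
      using bij that(1-3) by (auto simp: bij_betw_def inj_on_def)
    then show ?thesis using E[OF that(2)] that(4) by (auto simp: primitive_idempotent_def)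
  qed
  have nonzero: "\<exists>v\<in>W. v \<noteq> 0" if W: "W \<in> eigenspaces scale f" and f: "endo f" for W f
  proof -
    obtain c where c: "W = eigenspace scale f c" "W \<noteq> {0}"
      using W unfolding eigenspaces_def by blast
    then have "0 \<in> W" using f by (simp add: eigenspace_def endo_zero)
    then show ?thesis using c(2) by auto
  qed
  have YE: "Y h \<in> eigenspaces scale A" and XE: "X h \<in> eigenspaces scale As" if "h \<le> d" for h
    using bij bijs that by (auto simp: bij_betw_def)
  have q: "q \<noteq> 0" "a \<noteq> 0" "b \<noteq> 0" using assms(5) by (auto simp: q_Racah_type_with_def)
  have flip: "q powi (2 * i - int d) = inverse (q powi (int d - 2 * i))" for i
    using power_int_minus[of q "int d - 2 * i"] by simp
  have Y_eq: "Y h = eigenspace scale A (th (int h))" and X_eq: "X h = eigenspace scale As (ths (int h))"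
    if "h \<le> d" for h
    using assms(5) that by (auto simp: q_Racah_type_with_def X_def Y_def th_def ths_def a'_def flip)
  have A_Y: "A v = scale (th (int h)) v" if "h \<le> d" "v \<in> Y h" for h v
    using Y_eq that by (auto simp: eigenspace_def)
  have As_X: "As v = scale (ths (int h)) v" if "h \<le> d" "v \<in> X h" for h v
    using X_eq that by (auto simp: eigenspace_def)
  have sub_Y: "subspace (Y h)" if "h \<le> d" for h
    unfolding Y_eq[OF that] eigenspace_def
    by (rule subspaceI) (simp_all add: endo_simps[OF A] algebra_simps)
  have sub_X: "subspace (X h)" if "h \<le> d" for h
    unfolding X_eq[OF that] eigenspace_def
    by (rule subspaceI) (simp_all add: endo_simps[OF As] algebra_simps)
  have Y_span: "sum_span Y {..d} = UNIV" and X_span: "sum_span X {..d} = UNIV"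
    using pair bij bijs by (auto simp: diagonalizable_def sum_span_def bij_betw_def)
  have tri_A: "A v \<in> sum_span X {l. l \<le> d \<and> int h - 1 \<le> int l \<and> int l \<le> int h + 1}" if "h \<le> d" "v \<in> X h" for h v
    using ords tridiagonal_subset_sum_span[OF that(1)] that by (fastforce simp: standard_ordering_def)
  have tri_As: "As v \<in> sum_span Y {l. l \<le> d \<and> int h - 1 \<le> int l \<and> int l \<le> int h + 1}" if "h \<le> d" "v \<in> Y h" for h v
    using ord tridiagonal_subset_sum_span[OF that(1)] that by (fastforce simp: standard_ordering_def)
  have th_inj: "h = l" if "h \<le> d" "l \<le> d" "th (int h) = th (int l)" for h l
    using bij that Y_eq[OF that(1)] Y_eq[OF that(2)] by (auto simp: bij_betw_def inj_on_def)
  have irr: "W = {0} \<or> W = UNIV" if "subspace W" "A ` W \<subseteq> W" "As ` W \<subseteq> W" for W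
    using pair that by blast
  have A_X: "A v \<in> sum_span X {l. l \<le> d \<and> int l \<le> int h + 1}" if "h \<le> d" "v \<in> X h" for h v
    using tri_A[OF that] by (rule set_mp[OF sum_span_mono, rotated]) auto
  have As_Y: "As v \<in> sum_span Y {l. l \<le> d \<and> int h - 1 \<le> int l}" if "h \<le> d" "v \<in> Y h" for h v
    using tri_As[OF that] by (rule set_mp[OF sum_span_mono, rotated]) auto
  have rev_span: "sum_span (\<lambda>h. Y (d - h)) J = sum_span Y ((\<lambda>h. d - h) ` J)" for J
    by (simp add: sum_span_def image_image)
  \<comment> \<open>Reversing the order of the eigenspaces brings in the other half of the
    tridiagonality condition.\<close>
  have As_Y': "As v \<in> sum_span (\<lambda>h. Y (d - h)) {l. l \<le> d \<and> int h - 1 \<le> int l}"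
    if "h \<le> d" "v \<in> Y (d - h)" for h v
  proof -
    have "l \<in> (\<lambda>h. d - h) ` {l. l \<le> d \<and> int h - 1 \<le> int l}"
      if "l \<le> d" "int l \<le> int (d - h) + 1" for l
      using that \<open>h \<le> d\<close> by (intro image_eqI[of _ _ "d - l"]) auto
    then have "{l. l \<le> d \<and> int (d - h) - 1 \<le> int l \<and> int l \<le> int (d - h) + 1}
        \<subseteq> (\<lambda>h. d - h) ` {l. l \<le> d \<and> int h - 1 \<le> int l}"
      by blast
    then show ?thesis
      unfolding rev_span using tri_As[of "d - h" v] that(2) sum_span_mono by (meson diff_le_self subsetD)
  qed
  have Y_span': "sum_span (\<lambda>h. Y (d - h)) {..d} = UNIV"
  proof -
    have "x \<in> (\<lambda>h. d - h) ` {..d}" if "x \<le> d" for x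
      using that by (intro image_eqI[of _ _ "d - x"]) auto
    then have "(\<lambda>h. d - h) ` {..d} = {..d}" by auto
    then show ?thesis unfolding rev_span by (simp add: Y_span)
  qed
  obtain y0 yd where y: "y0 \<in> Y 0" "y0 \<noteq> 0" "yd \<in> Y d" "yd \<noteq> 0"
    using nonzero[OF YE A] by blast
  have Y_proper: "sum_span Y {1..d} \<noteq> UNIV"
    by (rule idempotent_separates[of "E 0" _ _ y0]) (use y endo_E E_other E_same in auto)
  have Y_proper': "sum_span (\<lambda>h. Y (d - h)) {1..d} \<noteq> UNIV"
  proof (rule idempotent_separates[of "E d" _ _ yd])
    fix h x assume h: "h \<in> {1..d}" and "x \<in> Y (d - h)"
    then show "E d x = 0" using E_other[of "d - h" d x] by auto
  qed (use y endo_E E_same in auto)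
  have X_0: "\<exists>v\<in>X 0. v \<noteq> 0" using nonzero[OF XE As] by blast
  have A_Y': "A v = scale (th (int d - int h)) v" if "h \<le> d" "v \<in> Y (d - h)" for h v
    using A_Y[of "d - h" v] that by (simp add: of_nat_diff)
  have "td_flags scale A As X Y th ths d"
    by (rule td_flags.intro[OF endo_space_axioms td_flags_axioms.intro])
      (fact A As X_span Y_span Y_proper X_0 | erule (1) A_Y As_X A_X As_Y | erule (2) irr)+
  moreover have "td_flags scale A As X (\<lambda>h. Y (d - h)) (\<lambda>j. th (int d - j)) ths d"
    by (rule td_flags.intro[OF endo_space_axioms td_flags_axioms.intro])
      (fact A As X_span Y_span' Y_proper' X_0 | erule (1) A_Y' As_X A_X As_Y' | erule (2) irr)+
  moreover have "two_splits_axioms scale Y th d E"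
    by (rule two_splits_axioms.intro)
      (erule endo_E | erule (1) E_same | erule (3) E_other | erule (2) th_inj)+
  ultimately interpret two_splits scale A As X Y th ths d E
    by (rule two_splits.intro)
  have K: "endo K" "\<And>i u. i \<le> d \<Longrightarrow> u \<in> split_decomp d E Es i \<Longrightarrow> K u = scale (q powi (int d - 2 * int i)) u"
    and B: "endo B" "\<And>i u. i \<le> d \<Longrightarrow> u \<in> split_decomp_down d E Es i \<Longrightarrow> B u = scale (q powi (int d - 2 * int i)) u"
    using assms(6,7) by (auto simp: acts_on_split_def)
  have F_sum: "up.F i \<subseteq> (\<Sum>h\<le>nat i. range (Es h))" if "0 \<le> i" "i \<le> int d" for i
  proof -
    have "{h. h \<le> d \<and> int h \<le> i} = {..nat i}" using that by auto
    then show ?thesis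
      using sum_span_subset_set_sum[of "{..nat i}" X] sub_X that by (simp add: up.F_def X_def)
  qed
  have K_U: "K v = scale (q powi (int d - 2 * i)) v"
    if i: "0 \<le> i" "i \<le> int d" and v: "v \<in> up.F i" "v \<in> up.G i" for i v
  proof -
    have "{h. h \<le> d \<and> i \<le> int h} = {nat i..d}" using i by auto
    then have "v \<in> (\<Sum>h=nat i..d. range (E h))"
      using sum_span_subset_set_sum[of "{nat i..d}" Y] sub_Y v(2) by (auto simp: up.G_def Y_def)
    then have "v \<in> split_decomp d E Es (nat i)"
      using F_sum[OF i] v(1) by (auto simp: split_decomp_def)
    then show ?thesis using K(2)[of "nat i" v] i by simp
  qed
  have B_U: "B v = scale (q powi (int d - 2 * i)) v"
    if i: "0 \<le> i" "i \<le> int d" and v: "v \<in> up.F i" "v \<in> down.G i" for i v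
  proof -
    have "{h. h \<le> d \<and> int h \<le> int d - i} = {..d - nat i}" using i by auto
    then have "v \<in> (\<Sum>h\<le>d - nat i. range (E h))"
      using sum_span_subset_set_sum[of "{..d - nat i}" Y] sub_Y v(2)[unfolded down_G_eq]
      by (auto simp: Y_def)
    then have "v \<in> split_decomp_down d E Es (nat i)"
      using F_sum[OF i] v(1) by (auto simp: split_decomp_down_def)
    then show ?thesis using B(2)[of "nat i" v] i by simp
  qed
  have aa': "a * a' = 1" using q(2) by (simp add: a'_def)
  have th_rev: "th (int d - i) = a' * q powi (int d - 2 * i) + a * inverse (q powi (int d - 2 * i))" for i
  proof -
    have "q powi (int d - 2 * (int d - i)) = inverse (q powi (int d - 2 * i))"
      using flip[of i] by (simp add: algebra_simps)
    then show ?thesis by (simp add: th_def)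
  qed
  \<comment> \<open>If \<open>a = a'\<close>, reversal fixes the eigenvalue sequence, so its first
    and last terms coincide although \<open>d \<ge> 1\<close>.\<close>
  have a_neq: "a \<noteq> a'"
  proof
    assume eq: "a = a'"
    have "th (int d - 0) = th 0"
      unfolding th_rev by (simp only: th_def eq)
    then have "th (int 0) = th (int d)" by simp
    then show False using th_inj[of 0 d] assms(4) by simp
  qed
  \<comment> \<open>Otherwise the eigenvalues with indices \<open>0\<close> and \<open>k\<close>
    coincide.\<close>
  have q_pow: "(q\<^sup>2) ^ k \<noteq> 1" if "1 \<le> k" "k \<le> d" for k
  proof
    assume "(q\<^sup>2) ^ k = 1"
    then have "q powi int (2 * k) = 1" unfolding power_int_of_nat power_mult .
    moreover have "q powi (int d - int (2 * k)) = q powi int d / q powi int (2 * k)"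
      using q(1) by (intro power_int_diff) simp
    ultimately have "q powi (int d - 2 * int k) = q powi (int d - 2 * int 0)" by simp
    then have "th (int 0) = th (int k)" by (simp only: th_def)
    then show False using th_inj[of 0 k] that by simp
  qed
  have "q_split_axioms scale X Y th d q a a' K"
    by (rule q_split_axioms.intro) (fact q(1) aa' th_def K(1) | rule K_U)+
  then have "q_split scale A As X Y th ths d q a a' K"
    using up.td_flags_axioms by (intro q_split.intro)
  moreover have "q_split_axioms scale X (\<lambda>h. Y (d - h)) (\<lambda>j. th (int d - j)) d q a' a B"
    by (rule q_split_axioms.intro) (fact q(1) aa'[unfolded mult.commute[of a]] th_rev B(1) | rule B_U)+
  then have "q_split scale A As X (\<lambda>h. Y (d - h)) (\<lambda>j. th (int d - j)) ths d q a' a B"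
    using down.td_flags_axioms by (intro q_split.intro)
  moreover have "racah_splits_axioms d q a a' (q\<^sup>2)"
    by (rule racah_splits_axioms.intro) (fact refl assms(4) a_neq | rule q_pow)+
  ultimately interpret racah_splits scale A As X Y th ths d E q a a' K B "q\<^sup>2"
    using two_splits_axioms by (intro racah_splits.intro)
  let ?W = "M_eigenspace scale d q a K B"
  have W_iff: "v \<in> ?W i \<longleftrightarrow> S v = scale ((a - a') * ev (int i)) v" for v i
  proof -
    have "M_map scale a K B v = scale (inverse (a - a')) (S v)"
      unfolding M_map_def S_def unfolding a'_def ..
    moreover have "scale (inverse (a - a')) (S v) = scale (ev (int i)) v
        \<longleftrightarrow> S v = scale ((a - a') * ev (int i)) v" (is "?l \<longleftrightarrow> ?r")
    proof
      assume ?l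
      then have "scale (a - a') (scale (inverse (a - a')) (S v)) = scale (a - a') (scale (ev (int i)) v)"
        by simp
      then show ?r using a_neq by simp
    next
      assume ?r
      then show ?l using a_neq by simp
    qed
    ultimately show ?thesis by (simp add: M_eigenspace_def eigenspace_def upq.ev_def)
  qed
  have W_scale: "scale e v \<in> ?W i" if "v \<in> ?W i" for e v i
    using that by (simp add: W_iff endo_scale[OF endo_S] mult.commute)
  show ?thesis
  proof (intro allI impI subsetI)
    fix i w assume i: "i \<le> d" and "w \<in> (\<lambda>v. A v - scale ((a + inverse a) * q powi (int d - 2 * int i)) v) ` ?W i"
    then obtain v where v: "S v = scale ((a - a') * ev (int i)) v"
      and w: "w = A v - scale ((a + a') * ev (int i)) v"
      by (auto simp: W_iff a'_def upq.ev_def)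
    \<comment> \<open>On an eigenvector of \<open>S\<close>, \<open>A_P_D\<close> expresses the map
      of the theorem by \<open>P\<close>, which raises the index, and \<open>D\<close>, which lowers
      it.\<close>
    have "scale (a - a') w = P v - D v"
      unfolding A_P_D [symmetric] v w by (simp add: scale_right_diff_distrib mult.left_commute)
    then have "scale (inverse (a - a')) (scale (a - a') w) = scale (inverse (a - a')) (P v - D v)"
      by simp
    then have "w = scale (inverse (a - a')) (P v - D v)" using a_neq by simp
    then have w_eq: "w = scale (- inverse (a - a')) (D v) + scale (inverse (a - a')) (P v)"
      by (simp add: scale_right_diff_distrib)
    have "scale (- inverse (a - a')) (D v) \<in> padded d ?W (int i - 1)"
    proof (cases i)
      case 0
      then have "D v = 0" using D_eigenvector_bot v by simp
      then show ?thesis using 0 by (simp add: padded_def)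
    next
      case (Suc j)
      then have "D v \<in> ?W j" using D_eigenvector[OF v] by (simp add: W_iff)
      then show ?thesis
        using Suc i W_scale[of "D v" j "- inverse (a - a')"] by (simp add: padded_def)
    qed
    moreover have "scale (inverse (a - a')) (P v) \<in> padded d ?W (int i + 1)"
    proof (cases "i = d")
      case True
      then have "P v = 0" using P_eigenvector_top v by simp
      then show ?thesis using True by (simp add: padded_def)
    next
      case False
      then have "P v \<in> ?W (Suc i)" using P_eigenvector[OF v] by (simp add: W_iff add.commute)
      then show ?thesis using False i W_scale by (simp add: padded_def nat_add_distrib)
    qed
    ultimately show "w \<in> padded d ?W (int i - 1) + padded d ?W (int i + 1)"
      unfolding w_eq by (rule set_plus_intro)
  qed
qed

end
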